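(* Let $\mu$ be a symmetric nonnegative Radon measure on $\mathbb{R}\setminus\{0\}$ with $\int (|z|^2\wedge 1)\,\mathrm{d}\mu(z)<+\infty$. Let $\overline{\operatorname{supp}(\mu)}^{\mathbb{R}}$ denote the closure of $\operatorname{supp}(\mu)$ in $\mathbb{R}$. (a) If $\overline{\operatorname{supp}(\mu)}^{\mathbb{R}}$ contains a (nondegenerate) interval, or has at least one accumulation point, then $\mathcal{L}^\mu$ has the Liouville property. (b) If the hypothesis of (a) does not hold, then: (i) If $\operatorname{supp}(\mu)$ contains only a finite number of points, $\operatorname{supp}(\mu)=\{-a_N,\dots,-a_1,a_1,\dots,a_N\}$ with $0<a_1<\dots<a_N$, then $\mathcal{L}^\mu$ has the Liouville property if and only if $\frac{a_n}{a_1}\notin\mathbb{Q}$ for some $n\in\{1,\dots,N\}$. (ii) If $\operatorname{supp}(\mu)$ has an infinite number of points, $\operatorname{supp}(\mu)=\{-a_n,a_n\}_{n\ge1}$ with $0<a_1<a_2<\dots$, let $q_n$ be the positive denominator of $\frac{a_n}{a_1}=\frac{p_n}{q_n}$ written in irreducible form, with $q_n:=+\infty$ if $\frac{a_n}{a_1}\notin\mathbb{Q}$. Then $\mathcal{L}^\mu$ has the Liouville property if and only if $\sup_{n\ge1}q_n=+\infty$.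
   Context: A nonnegative Radon measure on $\mathbb{R}\setminus\{0\}$ is a nonnegative Borel measure on $\mathbb{R}\setminus\{0\}$ finite on compact subsets of $\mathbb{R}\setminus\{0\}$. It is symmetric if $\mu(B)=\mu(-B)$ for all Borel $B$. Its support is $\operatorname{supp}(\mu)=\{z\in\mathbb{R}\setminus\{0\}:\mu(B_r(z))>0\ \forall r>0\}$, where $B_r(z)$ is the ball of center $z$ and radius $r$ (the support never contains $0$, though its closure in $\mathbb{R}$ may). The symbol $\wedge$ denotes the minimum. The operator $\mathcal{L}^\mu$ is $$\mathcal{L}^\mu[\psi](x)=\mathrm{P.V.}\int_{\mathbb{R}\setminus\{0\}}\big(\psi(x+z)-\psi(x)\big)\,\mathrm{d}\mu(z)=\lim_{r\to0^+}\int_{|z|>r}\big(\psi(x+z)-\psi(x)\big)\,\mathrm{d}\mu(z),$$ well defined for $C^2$ functions $\psi$ bounded together with their derivatives up to order two. For $u\in L^\infty(\mathbb{R})$, "$\mathcal{L}^\mu[u]=0$ in $\mathcal{D}'(\mathbb{R})$" means $\int_{\mathbb{R}}u(x)\,\mathcal{L}^\mu[\psi](x)\,\mathrm{d}x=0$ for all $\psi\in C_c^\infty(\mathbb{R})$. $\mathcal{L}^\mu$ has the Liouville property if every $u\in L^\infty(\mathbb{R})$ satisfying $\mathcal{L}^\mu[u]=0$ in $\mathcal{D}'(\mathbb{R})$ is constant (almost everywhere). *)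

theory Defs
  imports "HOL-Analysis.Analysis" "HOL-Library.Extended_Nat"
begin

text \<open>
  Measures on \<open>\<real> \<setminus> {0}\<close> are values of type \<^typ>\<open>real measure\<close> whose underlying space is the
  punctured line, so sets containing \<open>0\<close> are not measurable and have to be intersected
  with \<^term>\<open>space \<mu>\<close> before being measured.
\<close>

definition punctured_radon :: "real measure \<Rightarrow> bool" where
  "punctured_radon \<mu> \<longleftrightarrow>
     sets \<mu> = sets (restrict_space borel (- {0})) \<and>
     (\<forall>K. compact K \<and> K \<subseteq> - {0} \<longrightarrow> emeasure \<mu> K < \<infinity>)"

definition symmetric_measure :: "real measure \<Rightarrow> bool" where
  "symmetric_measure \<mu> \<longleftrightarrow> (\<forall>B \<in> sets \<mu>. emeasure \<mu> B = emeasure \<mu> (uminus ` B))"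

definition supp :: "real measure \<Rightarrow> real set" where
  "supp \<mu> = {z \<in> - {0}. \<forall>r>0. emeasure \<mu> (ball z r \<inter> - {0}) > 0}"

text \<open>
  The principal value. \<^const>\<open>Lim\<close> and the Bochner integral are total functions with unspecified
  or zero values where they do not exist; for symmetric \<open>\<mu>\<close> integrating \<open>|z|\<^sup>2 \<and> 1\<close>
  and a \<open>C\<^sup>2\<close> function \<open>\<psi>\<close> bounded with its first two derivatives, the integrals and the limit exist.
\<close>

definition levy_op :: "real measure \<Rightarrow> (real \<Rightarrow> real) \<Rightarrow> real \<Rightarrow> real" where
  "levy_op \<mu> \<psi> x =
     Lim (at_right 0) (\<lambda>r. set_lebesgue_integral \<mu> {z. \<bar>z\<bar> > r} (\<lambda>z. \<psi> (x + z) - \<psi> x))"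

definition test_function :: "(real \<Rightarrow> real) \<Rightarrow> bool" where
  "test_function \<psi> \<longleftrightarrow>
     (\<forall>k x. (deriv ^^ k) \<psi> differentiable (at x)) \<and> compact (closure {x. \<psi> x \<noteq> 0})"

definition L_infinity :: "(real \<Rightarrow> real) \<Rightarrow> bool" where
  "L_infinity u \<longleftrightarrow>
     u \<in> borel_measurable lebesgue \<and> (\<exists>C. AE x in lebesgue. \<bar>u x\<bar> \<le> C)"

text \<open>
  For \<open>\<mu>\<close> as above and a test function \<open>\<psi>\<close>, \<^term>\<open>levy_op \<mu> \<psi>\<close> is
  integrable, so the integral below is meaningful for every essentially bounded \<open>u\<close>.
\<close>

definition distributional_solution :: "real measure \<Rightarrow> (real \<Rightarrow> real) \<Rightarrow> bool" where
  "distributional_solution \<mu> u \<longleftrightarrow>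
     (\<forall>\<psi>. test_function \<psi> \<longrightarrow> (LINT x|lebesgue. u x * levy_op \<mu> \<psi> x) = 0)"

definition liouville_property :: "real measure \<Rightarrow> bool" where
  "liouville_property \<mu> \<longleftrightarrow>
     (\<forall>u. L_infinity u \<and> distributional_solution \<mu> u \<longrightarrow> (\<exists>c. AE x in lebesgue. u x = c))"

definition interval_or_accumulation :: "real set \<Rightarrow> bool" where
  "interval_or_accumulation C \<longleftrightarrow> (\<exists>c d. c < d \<and> {c..d} \<subseteq> C) \<or> (\<exists>x. x islimpt C)"

text \<open>
  \<open>S\<close> is listed as \<open>\<plusminus> a n\<close> with \<open>n\<close> running over \<open>I\<close>
  and the \<open>a n\<close> positive and strictly increasing.
\<close>

definition symmetric_listing :: "nat set \<Rightarrow> (nat \<Rightarrow> real) \<Rightarrow> real set \<Rightarrow> bool" where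
  "symmetric_listing I a S \<longleftrightarrow>
     (\<forall>n\<in>I. 0 < a n) \<and> strict_mono_on I a \<and> S = (\<Union>n\<in>I. {- a n, a n})"

definition denominator :: "real \<Rightarrow> enat" where
  "denominator x =
     (if x \<in> \<rat>
      then enat (THE q. 0 < q \<and> (\<exists>p::int. coprime p (int q) \<and> x = of_int p / of_nat q))
      else \<infinity>)"

end

theory Submission
  imports Defs
begin

text \<open>
  By Fubini, a bounded distributional solution \<open>u\<close> gives, for each test function \<open>\<phi>\<close>, a bounded
  uniformly continuous \<open>V x = \<integral> u y \<phi> (y - x) dy\<close> whose second differences integrate to zero
  against the measure. If \<open>a\<close> lies in the support and \<open>W x = V (x + a) - V x\<close> had a positive
  supremum, then a near-maximum of \<open>W\<close> at \<open>x\<close> would force near-maxima at \<open>x + a, x + 2 a, \<dots>\<close>, so that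
  \<open>V\<close> would grow linearly along this progression. Hence every point of the support is a period of
  \<open>V\<close>. If the support lies in no lattice \<open>d \<int>\<close>, these periods are dense, \<open>V\<close> is constant and so is
  \<open>u\<close>; if it lies in \<open>d \<int>\<close>, then \<open>cos (2 \<pi> x / d)\<close> is a nonconstant solution. It remains to
  decide when the support lies in a lattice.
\<close>

section \<open>Smooth bump functions\<close>

text \<open>Three obstacles shape the argument. A bounded \<open>u\<close> is defined only almost
  everywhere, so no maximum principle applies to it pointwise; hence the passage to
  \<open>V\<close>. Going back from \<open>V\<close> to \<open>u\<close> takes enough test
  functions, which is why smooth approximations of interval indicators are built. A supremum over
  the line need not be attained, and near-maximal points may escape to infinity. The strong maximum
  principle is therefore made quantitative, with tolerances and finitely many steps. Near the origin
  the measure may have infinite mass. Its symmetry turns the principal value into half the integral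
  of a second difference, which is bounded by a multiple of \<open>min (z\<^sup>2) 1\<close>; Fubini
  and dominated convergence then apply. As for lattices, an accumulation point is incompatible with
  a positive spacing, and for a listed support lying in a lattice amounts to a common bound on the
  denominators of the ratios \<open>a n / a 1\<close>.\<close>

lemma higher_deriv_differentiable:
  assumes "\<And>f x. f \<in> S \<Longrightarrow> f differentiable (at x)" "\<And>f. f \<in> S \<Longrightarrow> deriv f \<in> S" "f \<in> S"
  shows "(deriv ^^ k) f differentiable (at x)"
proof -
  have "(deriv ^^ k) f \<in> S"
    by (induction k) (use assms in auto)
  then show ?thesis using assms(1) by blast
qed

text \<open>
  All derivatives of \<open>exp (- 1 / x)\<close>, extended by \<open>0\<close> to \<open>x \<le> 0\<close>, are of this form, with another
  polynomial \<open>p\<close>.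
\<close>

definition expinv :: "real poly \<Rightarrow> real \<Rightarrow> real" where
  "expinv p x = (if x > 0 then poly p (inverse x) * exp (- inverse x) else 0)"

lemma poly_exp_minus_tendsto_0: "((\<lambda>t. poly p t * exp (- t :: real)) \<longlongrightarrow> 0) at_top"
proof -
  have "((\<lambda>t. \<Sum>i\<le>degree p. coeff p i * (t ^ i / exp t)) \<longlongrightarrow> (\<Sum>i\<le>degree p. coeff p i * 0)) at_top"
    by (intro tendsto_sum tendsto_mult tendsto_const tendsto_power_div_exp_0)
  moreover have "(\<lambda>t. \<Sum>i\<le>degree p. coeff p i * (t ^ i / exp t)) = (\<lambda>t. poly p t * exp (- t))"
    by (simp add: poly_altdef exp_minus sum_distrib_right divide_inverse mult.assoc)
  ultimately show ?thesis by simp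
qed

text \<open>In the variable s = 1/x one has d/dx = - s^2 d/ds, so p(s) exp(-s) has derivative s^2
  (p(s) - p'(s)) exp(-s); the two \<open>pCons 0\<close> multiply by s^2.\<close>

lemma expinv_has_derivative:
  "(expinv p has_real_derivative expinv (pCons 0 (pCons 0 (p - pderiv p))) x) (at x)"
proof -
  consider "x > 0" | "x < 0" | "x = 0" by linarith
  then show ?thesis
  proof cases
    case 1
    have "((\<lambda>y. poly p (inverse y) * exp (- inverse y)) has_real_derivative
        expinv (pCons 0 (pCons 0 (p - pderiv p))) x) (at x)"
      using 1 by (auto intro!: derivative_eq_intros DERIV_chain2[OF poly_DERIV]
          simp: expinv_def field_simps power2_eq_square)
    then show ?thesis
      by (rule has_field_derivative_transform_within_open[where S = "{0<..}"])
        (use 1 in \<open>auto simp: expinv_def\<close>)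
  next
    case 2
    have "((\<lambda>y. 0) has_real_derivative expinv (pCons 0 (pCons 0 (p - pderiv p))) x) (at x)"
      using 2 by (simp add: expinv_def)
    then show ?thesis
      by (rule has_field_derivative_transform_within_open[where S = "{..<0}"])
        (use 2 in \<open>auto simp: expinv_def\<close>)
  next
    case 3
    have "((\<lambda>h. expinv p h / h) \<longlongrightarrow> 0) (at 0)"
      unfolding filterlim_at_split
    proof
      show "((\<lambda>h. expinv p h / h) \<longlongrightarrow> 0) (at_left 0)"
        by (rule tendsto_eventually) (auto simp: expinv_def eventually_at_filter)
      \<comment> \<open>For \<open>h > 0\<close> the difference quotient is s p(s) exp(-s) with s =
        1/h; the extra \<open>pCons 0\<close> is the division by \<open>h\<close>.\<close>
      have "((\<lambda>h. poly (pCons 0 p) (inverse h) * exp (- inverse h)) \<longlongrightarrow> 0) (at_right (0::real))"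
        by (rule filterlim_compose[OF poly_exp_minus_tendsto_0 filterlim_inverse_at_top_right])
      then show "((\<lambda>h. expinv p h / h) \<longlongrightarrow> 0) (at_right 0)"
        by (rule filterlim_mono_eventually)
          (auto simp: expinv_def eventually_at_filter field_simps)
    qed
    then show ?thesis
      using 3 by (simp add: DERIV_def expinv_def)
  qed
qed

text \<open>Products of rescaled \<open>expinv\<close> functions are not closed under
  differentiation, but their sums are. Closure under \<open>deriv\<close> is all that smoothness
  requires, so no formula for a k-th derivative appears.\<close>

inductive_set bump_algebra :: "(real \<Rightarrow> real) set" where
  base: "(\<lambda>x. expinv p (c * x + d)) \<in> bump_algebra"
| mult: "f \<in> bump_algebra \<Longrightarrow> g \<in> bump_algebra \<Longrightarrow> (\<lambda>x. f x * g x) \<in> bump_algebra"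
| add: "f \<in> bump_algebra \<Longrightarrow> g \<in> bump_algebra \<Longrightarrow> (\<lambda>x. f x + g x) \<in> bump_algebra"

lemma bump_algebra_deriv:
  assumes "f \<in> bump_algebra"
  shows "(\<forall>x. f differentiable (at x)) \<and> deriv f \<in> bump_algebra"
proof -
  have "\<exists>f' \<in> bump_algebra. \<forall>x. (f has_real_derivative f' x) (at x)"
    using assms
  proof induction
    case (base p c d)
    \<comment> \<open>The chain-rule factor \<open>c\<close> is absorbed into the polynomial, so
      that the derivative again has the form \<open>base\<close>.\<close>
    let ?q = "smult c (pCons 0 (pCons 0 (p - pderiv p)))"
    have "((\<lambda>x. expinv p (c * x + d)) has_real_derivative expinv ?q (c * x + d)) (at x)" for x
    proof -
      have "((\<lambda>x. c * x + d) has_real_derivative c) (at x)"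
        by (auto intro!: derivative_eq_intros)
      from DERIV_chain2[OF expinv_has_derivative this]
      have "((\<lambda>x. expinv p (c * x + d)) has_real_derivative
          expinv (pCons 0 (pCons 0 (p - pderiv p))) (c * x + d) * c) (at x)" .
      moreover have "expinv ?q y = expinv (pCons 0 (pCons 0 (p - pderiv p))) y * c" for y
        by (simp add: expinv_def)
      ultimately show ?thesis by (simp only:)
    qed
    then show ?case
      using bump_algebra.base[of ?q c d] by (rule_tac bexI) auto
  next
    case (mult f g)
    then obtain f' g' where *: "f' \<in> bump_algebra" "g' \<in> bump_algebra"
      "\<And>x. (f has_real_derivative f' x) (at x)" "\<And>x. (g has_real_derivative g' x) (at x)" by blast
    have "(\<lambda>x. f' x * g x + g' x * f x) \<in> bump_algebra"
      using mult.hyps * by (intro bump_algebra.intros)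
    then show ?case
      using * by (rule_tac bexI) (auto intro!: DERIV_mult)
  next
    case (add f g)
    then obtain f' g' where *: "f' \<in> bump_algebra" "g' \<in> bump_algebra"
      "\<And>x. (f has_real_derivative f' x) (at x)" "\<And>x. (g has_real_derivative g' x) (at x)" by blast
    have "(\<lambda>x. f' x + g' x) \<in> bump_algebra"
      using * by (intro bump_algebra.intros)
    then show ?case
      using * by (rule_tac bexI) (auto intro!: DERIV_add)
  qed
  then obtain f' where f': "f' \<in> bump_algebra" "\<And>x. (f has_real_derivative f' x) (at x)" by blast
  then have "deriv f = f'" by (intro ext DERIV_imp_deriv)
  with f' show ?thesis by (auto intro: real_differentiable_def[THEN iffD2])
qed

text \<open>For fixed t > 0 the value exp(-1/(n t)) tends to 1 as \<open>n\<close> grows, so these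
  smooth functions with values between 0 and 1 converge pointwise to the indicator of the open
  interval.\<close>

definition interval_bump :: "nat \<Rightarrow> real \<Rightarrow> real \<Rightarrow> real \<Rightarrow> real" where
  "interval_bump n a b x = expinv 1 (real n * (x - a)) * expinv 1 (real n * (b - x))"

lemma interval_bump_shift: "interval_bump n a b (y - x) = interval_bump n (a + x) (b + x) y"
  by (simp add: interval_bump_def algebra_simps)

lemma interval_bump_outside: "x \<notin> {a<..<b} \<Longrightarrow> interval_bump n a b x = 0"
  by (auto simp: interval_bump_def expinv_def zero_less_mult_iff)

lemma expinv_1_bounds: "0 \<le> expinv 1 x" "expinv 1 x \<le> 1"
  by (auto simp: expinv_def)

lemma interval_bump_bounds: "\<bar>interval_bump n a b x\<bar> \<le> 1"
  unfolding interval_bump_def abs_mult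
  by (rule mult_le_one) (use expinv_1_bounds in \<open>auto simp: abs_le_iff\<close>)

lemma expinv_1_tendsto:
  assumes "x > 0"
  shows "(\<lambda>n. expinv 1 (real n * x)) \<longlonglongrightarrow> 1"
proof -
  have "(\<lambda>n. exp (- (inverse x * inverse (real n)))) \<longlonglongrightarrow> exp (- (inverse x * 0))"
    by (intro tendsto_exp tendsto_minus tendsto_mult tendsto_const lim_inverse_n)
  moreover have "\<forall>\<^sub>F n in sequentially. exp (- (inverse x * inverse (real n))) = expinv 1 (real n * x)"
    using eventually_gt_at_top[of 0]
    by eventually_elim (use assms in \<open>auto simp: expinv_def mult.commute\<close>)
  ultimately show ?thesis by (auto intro: Lim_transform_eventually)
qed

lemma interval_bump_tendsto:
  "(\<lambda>n. interval_bump n a b x) \<longlonglongrightarrow> indicator {a<..<b} x"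
proof (cases "x \<in> {a<..<b}")
  case True
  then have "(\<lambda>n. interval_bump n a b x) \<longlonglongrightarrow> 1 * 1"
    unfolding interval_bump_def by (intro tendsto_mult expinv_1_tendsto) auto
  with True show ?thesis by simp
next
  case False
  then show ?thesis by (simp add: interval_bump_outside)
qed

lemma test_function_interval_bump: "test_function (interval_bump n a b)"
proof -
  have "interval_bump n a b =
      (\<lambda>x. expinv 1 (real n * x + (- real n * a)) * expinv 1 (- real n * x + real n * b))"
    by (auto simp: interval_bump_def fun_eq_iff algebra_simps)
  then have "interval_bump n a b \<in> bump_algebra"
    by (simp only:) (intro bump_algebra.intros)
  then have "(deriv ^^ k) (interval_bump n a b) differentiable (at x)" for k x
    using bump_algebra_deriv
    by (intro higher_deriv_differentiable[where S = bump_algebra and f = "interval_bump n a b"]) blast+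
  moreover have "bounded {x. interval_bump n a b x \<noteq> 0}"
  proof (rule bounded_subset[OF bounded_closed_interval])
    show "{x. interval_bump n a b x \<noteq> 0} \<subseteq> {a..b}"
    proof
      fix x assume "x \<in> {x. interval_bump n a b x \<noteq> 0}"
      then show "x \<in> {a..b}" using interval_bump_outside[of x a b n] by (cases "x \<in> {a<..<b}") auto
    qed
  qed
  ultimately show ?thesis
    unfolding test_function_def compact_closure by (intro conjI allI)
qed

section \<open>Uniform bounds for test functions and their second differences\<close>

lemma vanishing_outside_deriv:
  fixes f :: "real \<Rightarrow> real"
  assumes "\<And>x. \<bar>x\<bar> > R \<Longrightarrow> f x = 0" "\<bar>x\<bar> > R"
  shows "deriv f x = 0"
proof -
  have "open {x::real. \<bar>x\<bar> > R}" by (intro open_Collect_less continuous_intros)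
  moreover have "((\<lambda>x. 0) has_real_derivative 0) (at x)" by simp
  ultimately have "(f has_real_derivative 0) (at x)"
    using assms by (elim has_field_derivative_transform_within_open[rotated]) auto
  then show ?thesis by (rule DERIV_imp_deriv)
qed

lemma continuous_compact_support_bounded:
  fixes f :: "real \<Rightarrow> real"
  assumes "\<And>x. \<bar>x\<bar> > R \<Longrightarrow> f x = 0" "continuous_on UNIV f"
  shows "\<exists>K\<ge>0. \<forall>x. \<bar>f x\<bar> \<le> K"
proof -
  have "bounded (f ` {-R..R})"
    by (intro compact_imp_bounded compact_continuous_image continuous_on_subset[OF assms(2)]) auto
  then obtain K where K: "\<And>x. x \<in> {-R..R} \<Longrightarrow> \<bar>f x\<bar> \<le> K"
    unfolding bounded_iff by (auto simp del: atLeastAtMost_iff)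
  have "\<bar>f x\<bar> \<le> max K 0" for x
    using K[of x] assms(1)[of x] by (cases "\<bar>x\<bar> > R") (auto simp: not_less abs_le_iff)
  then show ?thesis by (intro exI[of _ "max K 0"]) auto
qed

text \<open>All derivatives are continuous and vanish outside the same interval, hence are bounded.
  A single constant \<open>K\<close> serves for the size, the Lipschitz estimate and the second
  differences, so that later bounds carry only one.\<close>

lemma test_function_bounds:
  assumes "test_function \<psi>"
  obtains R K where "R > 0" "K \<ge> 0" "continuous_on UNIV \<psi>"
    "\<And>x. \<bar>x\<bar> > R \<Longrightarrow> \<psi> x = 0" "\<And>x. \<bar>\<psi> x\<bar> \<le> K"
    "\<And>x h. \<bar>\<psi> (x + h) - \<psi> x\<bar> \<le> K * \<bar>h\<bar>"
    "\<And>x z. \<bar>\<psi> (x + z) + \<psi> (x - z) - 2 * \<psi> x\<bar> \<le> K * z\<^sup>2"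
proof -
  have diff: "(deriv ^^ k) \<psi> differentiable (at x)" for k x
    using assms by (simp add: test_function_def)
  have d: "((deriv ^^ k) \<psi> has_real_derivative (deriv ^^ Suc k) \<psi> x) (at x)" for k x
    using diff[of k x] by (simp add: DERIV_deriv_iff_real_differentiable)
  have d0: "(\<psi> has_real_derivative deriv \<psi> x) (at x)" for x
    using d[of 0 x] by simp
  have d1: "(deriv \<psi> has_real_derivative deriv (deriv \<psi>) x) (at x)" for x
    using d[of 1 x] by simp
  have cont: "continuous_on UNIV ((deriv ^^ k) \<psi>)" for k
    using d[of k] by (intro continuous_at_imp_continuous_on) (auto intro: DERIV_isCont)
  have "bounded {x. \<psi> x \<noteq> 0}"
    using assms bounded_subset[OF compact_imp_bounded closure_subset] by (auto simp: test_function_def)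
  then obtain R where "R > 0" "\<And>x. \<psi> x \<noteq> 0 \<Longrightarrow> \<bar>x\<bar> \<le> R"
    unfolding bounded_pos by auto
  then have z: "\<bar>x\<bar> > R \<Longrightarrow> (deriv ^^ k) \<psi> x = 0" for k x
  proof (induction k arbitrary: x)
    case 0
    then show ?case using \<open>\<And>x. \<psi> x \<noteq> 0 \<Longrightarrow> \<bar>x\<bar> \<le> R\<close>[of x] by force
  next
    case (Suc k)
    then show ?case using vanishing_outside_deriv[of R "(deriv ^^ k) \<psi>" x] by simp
  qed
  have "\<forall>k. \<exists>K. K \<ge> 0 \<and> (\<forall>x. \<bar>(deriv ^^ k) \<psi> x\<bar> \<le> K)"
  proof
    fix k
    show "\<exists>K. K \<ge> 0 \<and> (\<forall>x. \<bar>(deriv ^^ k) \<psi> x\<bar> \<le> K)"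
      by (rule continuous_compact_support_bounded[OF z cont])
  qed
  then have "\<exists>B. \<forall>k. B k \<ge> 0 \<and> (\<forall>x. \<bar>(deriv ^^ k) \<psi> x\<bar> \<le> B k)" by (rule choice)
  then obtain B where B: "\<And>k. B k \<ge> 0" "\<And>k x. \<bar>(deriv ^^ k) \<psi> x\<bar> \<le> B k" by blast
  have B1: "\<bar>deriv \<psi> x\<bar> \<le> B 1" and B2: "\<bar>deriv (deriv \<psi>) x\<bar> \<le> B 2" for x
    using B(2)[of 1 x] B(2)[of 2 x] by (auto simp: numeral_2_eq_2)
  define K where "K = B 0 + B 1 + 2 * B 2"
  have K: "B 0 \<le> K" "B 1 \<le> K" "2 * B 2 \<le> K" "K \<ge> 0"
    using B(1)[of 0] B(1)[of 1] B(1)[of 2] by (auto simp: K_def)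
  have lip: "\<bar>\<psi> (x + h) - \<psi> x\<bar> \<le> B 1 * \<bar>h\<bar>" for x h
    using field_differentiable_bound[of UNIV \<psi> "deriv \<psi>" "B 1" "x + h" x] d0 B1
    by auto
  have lip1: "\<bar>deriv \<psi> y - deriv \<psi> x\<bar> \<le> B 2 * \<bar>y - x\<bar>" for x y
    using field_differentiable_bound[of UNIV "deriv \<psi>" "deriv (deriv \<psi>)" "B 2" y x] d1 B2
    by auto
  have second: "\<bar>\<psi> (x + z) + \<psi> (x - z) - 2 * \<psi> x\<bar> \<le> 2 * B 2 * z\<^sup>2" for x z
  proof -
    \<comment> \<open>The symmetrised function replaces a Taylor expansion: its derivative at
      \<open>t\<close> is at most \<open>2 * B 2 * \<bar>t\<bar>\<close>, and the mean value
      inequality between 0 and \<open>z\<close> supplies the second factor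
      \<open>\<bar>z\<bar>\<close>.\<close>
    let ?g = "\<lambda>t. \<psi> (x + t) + \<psi> (x - t)" and ?g' = "\<lambda>t. deriv \<psi> (x + t) - deriv \<psi> (x - t)"
    have "(?g has_real_derivative ?g' t) (at t)" for t
      by (auto intro!: derivative_eq_intros DERIV_chain2[OF d0])
    then have "\<And>t. t \<in> {-\<bar>z\<bar>..\<bar>z\<bar>} \<Longrightarrow> (?g has_real_derivative ?g' t) (at t within {-\<bar>z\<bar>..\<bar>z\<bar>})"
      by (auto intro: has_field_derivative_at_within)
    moreover have "norm (?g' t) \<le> 2 * B 2 * \<bar>z\<bar>" if "t \<in> {-\<bar>z\<bar>..\<bar>z\<bar>}" for t
    proof -
      have "\<bar>?g' t\<bar> \<le> B 2 * \<bar>2 * t\<bar>" using lip1[of "x + t" "x - t"] by simp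
      also have "\<dots> \<le> B 2 * (2 * \<bar>z\<bar>)" using that B(1)[of 2] by (intro mult_left_mono) auto
      finally show ?thesis by simp
    qed
    ultimately have "norm (?g z - ?g 0) \<le> 2 * B 2 * \<bar>z\<bar> * norm (z - 0)"
      by (intro field_differentiable_bound[of "{-\<bar>z\<bar>..\<bar>z\<bar>}" ?g ?g']) auto
    then show ?thesis by (simp add: power2_eq_square abs_mult_self_eq mult.assoc)
  qed
  show thesis
  proof (rule that)
    show "R > 0" "K \<ge> 0" by fact+
    show "continuous_on UNIV \<psi>" using cont[of 0] by simp
    show "\<bar>x\<bar> > R \<Longrightarrow> \<psi> x = 0" for x using z[of x 0] by simp
    show "\<bar>\<psi> x\<bar> \<le> K" for x using B(2)[of 0 x] K by simp
    show "\<bar>\<psi> (x + h) - \<psi> x\<bar> \<le> K * \<bar>h\<bar>" for x h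
      using order_trans[OF lip mult_right_mono[OF K(2)]] by simp
    show "\<bar>\<psi> (x + z) + \<psi> (x - z) - 2 * \<psi> x\<bar> \<le> K * z\<^sup>2" for x z
      using order_trans[OF second mult_right_mono[OF K(3)]] by simp
  qed
qed

section \<open>Bounded functions with translation-invariant pairings\<close>

lemma integral_bounded_times_supported:
  fixes u g :: "real \<Rightarrow> real"
  assumes [measurable]: "u \<in> borel_measurable borel" "g \<in> borel_measurable borel"
    and u: "\<And>x. \<bar>u x\<bar> \<le> C" and g: "\<And>x. \<bar>g x\<bar> \<le> A" "\<And>x. x \<notin> {a..b} \<Longrightarrow> g x = 0" and "a \<le> b"
  shows "integrable lborel (\<lambda>x. u x * g x)"
    and "(LINT x|lborel. \<bar>u x * g x\<bar>) \<le> C * A * (b - a)"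
    and "\<bar>LINT x|lborel. u x * g x\<bar> \<le> C * A * (b - a)"
proof -
  have C: "C \<ge> 0" and A: "A \<ge> 0"
    using u[of 0] g(1)[of 0] by linarith+
  have int: "integrable lborel (\<lambda>x. C * A * indicator {a..b} x)"
    by (intro integrable_mult_right) (simp add: integrable_indicator_iff emeasure_lborel_Icc_eq)
  have le: "\<bar>u x * g x\<bar> \<le> C * A * indicator {a..b} x" for x
    using u[of x] g[of x] C A by (auto simp: abs_mult indicator_def intro: mult_mono)
  show *: "integrable lborel (\<lambda>x. u x * g x)"
    by (rule Bochner_Integration.integrable_bound[OF int]) (use le C A in \<open>auto simp: abs_mult\<close>)
  have "(LINT x|lborel. \<bar>u x * g x\<bar>) \<le> (LINT x|lborel. C * A * indicator {a..b} x)"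
    by (intro integral_mono int integrable_abs * le)
  also have "\<dots> = C * A * (b - a)" using \<open>a \<le> b\<close> by simp
  finally show "(LINT x|lborel. \<bar>u x * g x\<bar>) \<le> C * A * (b - a)" .
  then show "\<bar>LINT x|lborel. u x * g x\<bar> \<le> C * A * (b - a)"
    using integral_abs_bound[of lborel "\<lambda>x. u x * g x"] by linarith
qed

text \<open>Writing n t = k + r with k a natural number and r in [0,1], additivity gives n (F t - t
  F 1) = F r - r F 1. The right side is bounded independently of n, which forces the defect to
  vanish.\<close>

lemma additive_bounded_imp_linear:
  fixes F :: "real \<Rightarrow> real"
  assumes add: "\<And>s t. 0 \<le> s \<Longrightarrow> 0 \<le> t \<Longrightarrow> F (s + t) = F s + F t"
    and bound: "\<And>t. 0 \<le> t \<Longrightarrow> \<bar>F t\<bar> \<le> C * t" and "0 \<le> t"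
  shows "F t = t * F 1"
proof -
  have mult: "F (real n * s) = real n * F s" if "0 \<le> s" for n s
    using that bound[of 0] by (induction n) (auto simp: algebra_simps add)
  have C: "C \<ge> 0" using bound[of 1] by linarith
  have le: "real n * \<bar>F t - t * F 1\<bar> \<le> C + \<bar>F 1\<bar>" for n
  proof -
    define k r where "k = nat \<lfloor>real n * t\<rfloor>" and "r = real n * t - real k"
    have "real k = of_int \<lfloor>real n * t\<rfloor>" using \<open>0 \<le> t\<close> by (simp add: k_def)
    then have r: "0 \<le> r" "r \<le> 1" unfolding r_def by linarith+
    have "real n * F t = F (real k * 1 + r)" using mult[OF \<open>0 \<le> t\<close>] by (simp add: r_def)
    also have "\<dots> = real k * F 1 + F r" using r mult[of 1 k] by (subst add) auto
    finally have "real n * (F t - t * F 1) = F r - r * F 1" by (simp add: r_def algebra_simps)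
    moreover have "\<bar>F r - r * F 1\<bar> \<le> C + \<bar>F 1\<bar>"
    proof -
      have "\<bar>F r\<bar> \<le> C" using bound[OF r(1)] mult_left_mono[OF r(2) C] by simp
      moreover have "\<bar>r * F 1\<bar> \<le> \<bar>F 1\<bar>"
        using mult_right_mono[OF r(2), of "\<bar>F 1\<bar>"] r(1) by (simp add: abs_mult)
      ultimately show ?thesis by linarith
    qed
    ultimately show ?thesis by (metis abs_mult abs_of_nat)
  qed
  show ?thesis
  proof (rule ccontr)
    assume "F t \<noteq> t * F 1"
    then obtain n where "C + \<bar>F 1\<bar> < real n * \<bar>F t - t * F 1\<bar>"
      using reals_Archimedean3[of "\<bar>F t - t * F 1\<bar>"] by auto
    with le[of n] show False by simp
  qed
qed

text \<open>Passing from bumps to indicators, the integral of \<open>u\<close> over an interval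
  depends only on the length. It is additive and bounded by a multiple of the length, hence
  proportional to it; so \<open>u\<close> has the same interval integrals as a constant, and
  uniqueness of densities concludes.\<close>

lemma AE_constant_if_translation_invariant:
  fixes u :: "real \<Rightarrow> real"
  assumes [measurable]: "u \<in> borel_measurable borel" and u: "\<And>x. \<bar>u x\<bar> \<le> C"
    and inv: "\<And>\<phi> x. test_function \<phi> \<Longrightarrow>
      (LINT y|lborel. u y * \<phi> (y - x)) = (LINT y|lborel. u y * \<phi> y)"
  shows "\<exists>c. AE x in lborel. u x = c"
proof -
  define I where "I a b = (LINT y|lborel. u y * indicator {a<..<b} y)" for a b :: real
  have C: "C \<ge> 0" using u[of 0] by linarith
  have int: "integrable lborel (\<lambda>y. u y * indicator {a<..<b} y)" for a b
    by (rule integral_bounded_times_supported(1)[of _ _ C 1 a "max a b"])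
      (use u in \<open>auto simp: indicator_def\<close>)
  have [measurable]: "interval_bump n a b \<in> borel_measurable borel" for n a b
    using test_function_bounds[OF test_function_interval_bump] borel_measurable_continuous_onI by metis
  have lim: "(\<lambda>n. LINT y|lborel. u y * interval_bump n a b y) \<longlonglongrightarrow> I a b" for a b
    unfolding I_def
  proof (rule integral_dominated_convergence[where w = "\<lambda>y. C * indicator {a..b} y"])
    show "integrable lborel (\<lambda>y. C * indicator {a..b} y)"
      by (intro integrable_mult_right) (simp add: integrable_indicator_iff emeasure_lborel_Icc_eq)
    show "AE y in lborel. (\<lambda>n. u y * interval_bump n a b y) \<longlonglongrightarrow> u y * indicator {a<..<b} y"
      by (intro always_eventually allI tendsto_mult tendsto_const interval_bump_tendsto)
    show "AE y in lborel. norm (u y * interval_bump n a b y) \<le> C * indicator {a..b} y" for n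
    proof (intro always_eventually allI)
      fix y
      show "norm (u y * interval_bump n a b y) \<le> C * indicator {a..b} y"
        using interval_bump_outside[of y a b n] interval_bump_bounds[of n a b y]
          mult_mono[OF u[of y] interval_bump_bounds[of n a b y] C]
        by (cases "y \<in> {a<..<b}") (auto simp: abs_mult C)
    qed
  qed auto
  have shift: "I (a + x) (b + x) = I a b" for a b x
  proof -
    have "(\<lambda>n. LINT y|lborel. u y * interval_bump n (a + x) (b + x) y) =
        (\<lambda>n. LINT y|lborel. u y * interval_bump n a b y)"
      using inv[OF test_function_interval_bump] by (simp add: interval_bump_shift)
    then have "(\<lambda>n. LINT y|lborel. u y * interval_bump n a b y) \<longlonglongrightarrow> I (a + x) (b + x)"
      using lim[of "a + x" "b + x"] by (simp only:)
    then show ?thesis using lim[of a b] by (rule LIMSEQ_unique)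
  qed
  have split: "I a c = I a b + I b c" if "a \<le> b" "b \<le> c" for a b c
  proof -
    have "I a b + I b c = (LINT y|lborel. u y * indicator {a<..<b} y + u y * indicator {b<..<c} y)"
      unfolding I_def by (rule Bochner_Integration.integral_add[symmetric]) (fact int)+
    also have "\<dots> = I a c"
      unfolding I_def using AE_lborel_singleton[of b] that
      by (intro integral_cong_AE) (auto elim!: eventually_mono simp: indicator_def)
    finally show ?thesis by simp
  qed
  have bound: "\<bar>I 0 t\<bar> \<le> C * t" if "0 \<le> t" for t
    unfolding I_def
    using integral_bounded_times_supported(3)[of u "indicator {0<..<t}" C 1 0 t] u that
    by (force simp: indicator_def)
  define c where "c = I 0 1"
  have lin: "I 0 t = t * I 0 1" if "0 \<le> t" for t
  proof (rule additive_bounded_imp_linear[of "I 0"])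
    show "I 0 (s + t) = I 0 s + I 0 t" if "0 \<le> s" "0 \<le> t" for s t
      using split[of 0 s "s + t"] shift[of 0 s t] that by (simp add: add.commute)
  qed (use bound that in auto)
  have I: "I a b = (b - a) * c" if "a \<le> b" for a b
  proof -
    have "I a b = I 0 (b - a)" using shift[of 0 a "b - a"] by simp
    also have "\<dots> = (b - a) * c" unfolding c_def using that by (intro lin) simp
    finally show ?thesis .
  qed
  have c: "\<bar>c\<bar> \<le> C" using bound[of 1] by (simp add: c_def)
  \<comment> \<open>\<open>u + C + 1\<close> is positive, so its normalisation is a density with respect to \<open>lborel\<close>\<close>
  define w where "w x = (u x + C + 1) / (c + C + 1)" for x
  have pos: "c + C + 1 > 0" using c by linarith
  have w: "w x \<ge> 0" for x
    using pos u[of x] by (auto simp: w_def intro!: divide_nonneg_pos)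
  have [measurable]: "w \<in> borel_measurable borel" unfolding w_def by measurable
  have intw: "integrable lborel (\<lambda>x. w x * indicator {a<..<b} x)"
    and Iw: "(LINT x|lborel. w x * indicator {a<..<b} x) = b - a" if "a \<le> b" for a b
  proof -
    have eq: "w x * indicator {a<..<b} x =
        (u x * indicator {a<..<b} x + (C + 1) * indicator {a<..<b} x) / (c + C + 1)" for x
      by (simp add: w_def field_simps)
    have i: "integrable lborel (\<lambda>x. (C + 1) * indicator {a<..<b} x)"
      using that by (intro integrable_mult_right) (simp add: integrable_indicator_iff emeasure_lborel_Ioo)
    show "integrable lborel (\<lambda>x. w x * indicator {a<..<b} x)"
      unfolding eq by (intro integrable_divide Bochner_Integration.integrable_add int i)
    have "(LINT x|lborel. w x * indicator {a<..<b} x) = (I a b + (C + 1) * (b - a)) / (c + C + 1)"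
      unfolding eq I_def integral_divide_zero
      using that by (subst Bochner_Integration.integral_add[OF int i]) simp
    also have "\<dots> = ((c + C + 1) * (b - a)) / (c + C + 1)" using that by (simp add: I algebra_simps)
    also have "\<dots> = b - a" using pos by simp
    finally show "(LINT x|lborel. w x * indicator {a<..<b} x) = b - a" .
  qed
  \<comment> \<open>Lebesgue measure is characterised by its values on boxes, and \<open>w\<close>
    integrates to the length over each interval. Uniqueness of densities then gives
    \<open>w = 1\<close>, that is \<open>u = c\<close>, almost everywhere.\<close>
  have "lborel = density lborel w"
  proof (rule lborel_eqI)
    fix l r :: real assume "\<And>b. b \<in> Basis \<Longrightarrow> l \<bullet> b \<le> r \<bullet> b"
    then have "l \<le> r" by simp
    have "emeasure (density lborel w) {l<..<r} = (\<integral>\<^sup>+x. ennreal (w x * indicator {l<..<r} x) \<partial>lborel)"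
      by (subst emeasure_density) (auto simp: ennreal_mult' ennreal_indicator w intro!: nn_integral_cong)
    also have "\<dots> = ennreal (r - l)"
      using intw[OF \<open>l \<le> r\<close>] Iw[OF \<open>l \<le> r\<close>] w
      by (subst nn_integral_eq_integral) auto
    finally show "emeasure (density lborel w) (box l r) = (\<Prod>b\<in>Basis. (r - l) \<bullet> b)"
      by (simp add: box_real)
  qed simp
  then have "density lborel w = density lborel (\<lambda>_. 1)" by (simp add: density_1)
  then have "AE x in lborel. ennreal (w x) = 1"
    by (subst (asm) sigma_finite_measure.density_unique_iff[OF sigma_finite_lborel]) auto
  then have "AE x in lborel. u x = c"
    by eventually_elim (use pos in \<open>auto simp: w_def field_simps\<close>)
  then show ?thesis by blast
qed

section \<open>Second differences and symmetric Levy measures\<close>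

text \<open>Half of its integral in \<open>z\<close> against a symmetric measure is the principal
  value; unlike the first difference, it is quadratically small at the origin for smooth
  \<open>f\<close>.\<close>

definition second_diff :: "(real \<Rightarrow> real) \<Rightarrow> real \<Rightarrow> real \<Rightarrow> real" where
  "second_diff f x z = f (x + z) + f (x - z) - 2 * f x"

lemma second_diff_measurable [measurable]:
  assumes [measurable]: "f \<in> borel_measurable borel"
  shows "second_diff f x \<in> borel_measurable borel"
  unfolding second_diff_def by measurable

lemma second_diff_bound:
  assumes "\<And>x. \<bar>f x\<bar> \<le> K" "\<And>x z. \<bar>second_diff f x z\<bar> \<le> K * z\<^sup>2"
  shows "\<bar>second_diff f x z\<bar> \<le> 4 * K * min (z\<^sup>2) 1"
proof -
  have "\<bar>second_diff f x z\<bar> \<le> 4 * K"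
    unfolding second_diff_def using assms(1)[of "x + z"] assms(1)[of "x - z"] assms(1)[of x] by linarith
  moreover have "0 \<le> K * z\<^sup>2" using assms(2)[of x z] by linarith
  then have "K * z\<^sup>2 \<le> 4 * K * z\<^sup>2" by linarith
  then have "\<bar>second_diff f x z\<bar> \<le> 4 * K * z\<^sup>2" using assms(2)[of x z] by linarith
  ultimately show ?thesis by (simp add: min_def)
qed

lemma test_function_measurable:
  assumes "test_function \<psi>"
  shows "\<psi> \<in> borel_measurable borel"
  using test_function_bounds[OF assms] borel_measurable_continuous_onI by metis

lemma test_function_shift:
  assumes "test_function \<psi>"
  shows "test_function (\<lambda>y. \<psi> (y - x))"
proof -
  have diff: "((deriv ^^ k) \<psi> has_real_derivative deriv ((deriv ^^ k) \<psi>) y) (at y)" for k y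
    using assms by (simp add: test_function_def DERIV_deriv_iff_real_differentiable)
  have d: "((\<lambda>y. (deriv ^^ k) \<psi> (y - x)) has_real_derivative deriv ((deriv ^^ k) \<psi>) (y - x)) (at y)" for k y
  proof -
    have "((\<lambda>y. y - x) has_real_derivative 1) (at y)" by (auto intro!: derivative_eq_intros)
    from DERIV_chain2[OF diff this] show ?thesis by simp
  qed
  have eq: "(deriv ^^ k) (\<lambda>y. \<psi> (y - x)) = (\<lambda>y. (deriv ^^ k) \<psi> (y - x))" for k
  proof (induction k)
    case (Suc k)
    have "deriv (\<lambda>y. (deriv ^^ k) \<psi> (y - x)) = (\<lambda>y. deriv ((deriv ^^ k) \<psi>) (y - x))"
      by (intro ext DERIV_imp_deriv d)
    with Suc show ?case by simp
  qed simp
  have "bounded ((\<lambda>y. x + y) ` {y. \<psi> y \<noteq> 0})"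
    using assms by (intro bounded_translation) (auto simp: test_function_def)
  also have "(\<lambda>y. x + y) ` {y. \<psi> y \<noteq> 0} = {y. \<psi> (y - x) \<noteq> 0}"
  proof safe
    fix y assume "\<psi> (y - x) \<noteq> 0"
    then show "y \<in> (\<lambda>y. x + y) ` {y. \<psi> y \<noteq> 0}" by (intro image_eqI[of _ _ "y - x"]) auto
  qed simp
  finally have "bounded {y. \<psi> (y - x) \<noteq> 0}" .
  then show ?thesis
    unfolding test_function_def compact_closure eq
    using d real_differentiable_def by blast
qed

text \<open>Translations pass from \<open>\<psi>\<close> to \<open>V\<close>, so estimates for test
  functions become estimates for \<open>V\<close>. The last bound has the absolute value inside the
  integral because Fubini will need it there.\<close>

lemma pairing_bounds:
  fixes u \<psi> :: "real \<Rightarrow> real"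
  assumes [measurable]: "u \<in> borel_measurable borel" and u: "\<And>x. \<bar>u x\<bar> \<le> C"
    and \<psi>: "test_function \<psi>"
  defines "V \<equiv> (\<lambda>x. LINT y|lborel. u y * \<psi> (y - x))"
  obtains B where "\<And>x. \<bar>V x\<bar> \<le> B" "\<And>x h. \<bar>h\<bar> \<le> 1 \<Longrightarrow> \<bar>V (x + h) - V x\<bar> \<le> B * \<bar>h\<bar>"
    "\<And>x z. integrable lborel (\<lambda>y. u y * second_diff \<psi> (y - x) z)"
    "\<And>x z. (LINT y|lborel. u y * second_diff \<psi> (y - x) z) = second_diff V x z"
    "\<And>x z. (LINT y|lborel. \<bar>u y * second_diff \<psi> (y - x) z\<bar>) \<le> B * min (z\<^sup>2) 1"
proof -
  have C: "C \<ge> 0" using u[of 0] by linarith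
  from \<psi> obtain R K where R: "R > 0" and K: "K \<ge> 0" and supp: "\<And>x. \<bar>x\<bar> > R \<Longrightarrow> \<psi> x = 0"
    and bound: "\<And>x. \<bar>\<psi> x\<bar> \<le> K" and lip: "\<And>x h. \<bar>\<psi> (x + h) - \<psi> x\<bar> \<le> K * \<bar>h\<bar>"
    and sd: "\<And>x z. \<bar>second_diff \<psi> x z\<bar> \<le> K * z\<^sup>2"
    unfolding second_diff_def by (rule test_function_bounds) blast
  have [measurable]: "\<psi> \<in> borel_measurable borel" by (rule test_function_measurable[OF \<psi>])
  have [measurable]: "(\<lambda>y. second_diff \<psi> (y - x) z) \<in> borel_measurable borel" for x z
    unfolding second_diff_def by measurable
  \<comment> \<open>Here 2 R + 2 is the length of an interval that also contains the supports after
    a shift by at most 1; it therefore serves for \<open>V\<close>, its increments and its second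
    differences with \<open>\<bar>z\<bar> \<le> 1\<close>.\<close>
  define B where "B = C * K * (2 * R + 2)"
  have B: "B \<ge> 0" using C K R by (simp add: B_def)
  have int: "integrable lborel (\<lambda>y. u y * \<psi> (y - x))"
    and intb: "(LINT y|lborel. \<bar>u y * \<psi> (y - x)\<bar>) \<le> B" for x
  proof -
    have *: "\<psi> (y - x) = 0" if "y \<notin> {x - (R + 1)..x + (R + 1)}" for y
      using that by (intro supp) auto
    show "integrable lborel (\<lambda>y. u y * \<psi> (y - x))"
      by (rule integral_bounded_times_supported(1)[where C = C and A = K and a = "x - (R + 1)" and b = "x + (R + 1)"])
        (use u bound * R in auto)
    have "(LINT y|lborel. \<bar>u y * \<psi> (y - x)\<bar>) \<le> C * K * (x + (R + 1) - (x - (R + 1)))"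
      by (rule integral_bounded_times_supported(2)) (use u bound * R in auto)
    also have "\<dots> = B" by (simp add: B_def)
    finally show "(LINT y|lborel. \<bar>u y * \<psi> (y - x)\<bar>) \<le> B" .
  qed
  have Vb: "\<bar>V x\<bar> \<le> B" for x
    unfolding V_def using intb[of x] integral_abs_bound[of lborel "\<lambda>y. u y * \<psi> (y - x)"] by linarith
  have eq: "u y * second_diff \<psi> (y - x) z =
      u y * \<psi> (y - (x - z)) + u y * \<psi> (y - (x + z)) - 2 * (u y * \<psi> (y - x))" for x y z
    by (simp add: second_diff_def algebra_simps)
  have sd_int: "integrable lborel (\<lambda>y. u y * second_diff \<psi> (y - x) z)" for x z
    unfolding eq by (intro Bochner_Integration.integrable_add Bochner_Integration.integrable_diff int integrable_mult_right)
  have sd_eq: "(LINT y|lborel. u y * second_diff \<psi> (y - x) z) = second_diff V x z" for x z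
    unfolding eq V_def second_diff_def[of "\<lambda>x. LINT y|lborel. u y * \<psi> (y - x)"] using int by simp
  have sd_bound: "(LINT y|lborel. \<bar>u y * second_diff \<psi> (y - x) z\<bar>) \<le> 4 * B * min (z\<^sup>2) 1" for x z
  proof (cases "\<bar>z\<bar> \<le> 1")
    case True
    have "(LINT y|lborel. \<bar>u y * second_diff \<psi> (y - x) z\<bar>) \<le>
        C * (K * z\<^sup>2) * (x + (R + 1) - (x - (R + 1)))"
    proof (rule integral_bounded_times_supported(2))
      show "second_diff \<psi> (y - x) z = 0" if "y \<notin> {x - (R + 1)..x + (R + 1)}" for y
        unfolding second_diff_def using that True by (auto simp: supp abs_le_iff)
    qed (use u sd R in auto)
    also have "\<dots> = B * z\<^sup>2" by (simp add: B_def)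
    also have "\<dots> \<le> 4 * B * z\<^sup>2" using B by (intro mult_right_mono) auto
    also have "z\<^sup>2 = min (z\<^sup>2) 1" using True by (simp add: min_def abs_square_le_1)
    finally show ?thesis .
  next
    case False
    \<comment> \<open>For large \<open>z\<close> no common interval of bounded length contains the
      three shifted supports. Each term is estimated separately, and the weights 1, 1, 2 give the
      factor 4.\<close>
    have "(LINT y|lborel. \<bar>u y * second_diff \<psi> (y - x) z\<bar>) \<le>
        (LINT y|lborel. \<bar>u y * \<psi> (y - (x - z))\<bar> + \<bar>u y * \<psi> (y - (x + z))\<bar> + 2 * \<bar>u y * \<psi> (y - x)\<bar>)"
      by (rule integral_mono)
        (use int sd_int in \<open>auto simp: eq intro!: integrable_abs Bochner_Integration.integrable_add\<close>)
    also have "\<dots> = (LINT y|lborel. \<bar>u y * \<psi> (y - (x - z))\<bar>) + (LINT y|lborel. \<bar>u y * \<psi> (y - (x + z))\<bar>)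
        + 2 * (LINT y|lborel. \<bar>u y * \<psi> (y - x)\<bar>)"
      using int[THEN integrable_abs] by simp
    also have "\<dots> \<le> 4 * B" using intb[of "x - z"] intb[of "x + z"] intb[of x] by linarith
    also have "min (z\<^sup>2) 1 = 1" using False by (simp add: min_def abs_square_le_1)
    then have "4 * B = 4 * B * min (z\<^sup>2) 1" by simp
    finally show ?thesis .
  qed
  have V_lip: "\<bar>V (x + h) - V x\<bar> \<le> B * \<bar>h\<bar>" if "\<bar>h\<bar> \<le> 1" for x h
  proof -
    have "V (x + h) - V x = (LINT y|lborel. u y * (\<psi> (y - (x + h)) - \<psi> (y - x)))"
      unfolding V_def right_diff_distrib using int by simp
    also have "\<bar>\<dots>\<bar> \<le> C * (K * \<bar>h\<bar>) * (x + (R + 1) - (x - (R + 1)))"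
    proof (rule integral_bounded_times_supported(3))
      show "\<bar>\<psi> (y - (x + h)) - \<psi> (y - x)\<bar> \<le> K * \<bar>h\<bar>" for y
        using lip[of "y - x" "- h"] by (simp add: algebra_simps)
      show "\<psi> (y - (x + h)) - \<psi> (y - x) = 0" if "y \<notin> {x - (R + 1)..x + (R + 1)}" for y
        using that \<open>\<bar>h\<bar> \<le> 1\<close> by (auto simp: supp abs_le_iff)
    qed (use u R in auto)
    also have "\<dots> = B * \<bar>h\<bar>" by (simp add: B_def)
    finally show ?thesis .
  qed
  show thesis
  proof (rule that[of "4 * B"])
    show "\<bar>V x\<bar> \<le> 4 * B" for x using Vb[of x] B by linarith
    show "\<bar>V (x + h) - V x\<bar> \<le> 4 * B * \<bar>h\<bar>" if "\<bar>h\<bar> \<le> 1" for x h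
      using V_lip[OF that, of x] mult_right_mono[of B "4 * B" "\<bar>h\<bar>"] B by linarith
  qed (use sd_int sd_eq sd_bound in auto)
qed

text \<open>The measure lives on all Borel sets of the line, with the origin null, so that balls and
  reflections can be measured without intersecting them with the punctured line.\<close>

locale symmetric_levy =
  fixes \<nu> :: "real measure"
  assumes sets_eq [measurable_cong, simp]: "sets \<nu> = sets borel"
    and zero: "emeasure \<nu> {0} = 0"
    and symmetric: "distr \<nu> borel uminus = \<nu>"
    and finite_levy: "(\<integral>\<^sup>+ z. ennreal (min (z\<^sup>2) 1) \<partial>\<nu>) < \<infinity>"
begin

lemma space_eq [simp]: "space \<nu> = UNIV"
  using sets_eq_imp_space_eq[OF sets_eq] by simp

lemma integrable_min: "integrable \<nu> (\<lambda>z. min (z\<^sup>2) 1)"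
  by (rule integrableI_nonneg) (use finite_levy in auto)

lemma integrable_away: "r > 0 \<Longrightarrow> integrable \<nu> (indicator {z. \<bar>z\<bar> > r} :: real \<Rightarrow> real)"
proof -
  assume r: "r > 0"
  have c: "min (r\<^sup>2) 1 > 0" using r by simp
  have le: "min (r\<^sup>2) 1 \<le> min (z\<^sup>2) 1" if "\<bar>z\<bar> > r" for z :: real
    using power_mono[of r "\<bar>z\<bar>" 2] r that by (simp add: min_le_iff_disj)
  have "integrable \<nu> (\<lambda>z. min (z\<^sup>2) 1 / min (r\<^sup>2) 1)"
    by (intro integrable_divide integrable_min)
  then show ?thesis
  proof (rule Bochner_Integration.integrable_bound)
    show "AE z in \<nu>. norm (indicator {z. \<bar>z\<bar> > r} z :: real) \<le> norm (min (z\<^sup>2) 1 / min (r\<^sup>2) 1)"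
    proof (intro always_eventually allI)
      fix z :: real
      show "norm (indicator {z. \<bar>z\<bar> > r} z :: real) \<le> norm (min (z\<^sup>2) 1 / min (r\<^sup>2) 1)"
      proof (cases "\<bar>z\<bar> > r")
        case True
        have "1 \<le> min (z\<^sup>2) 1 / min (r\<^sup>2) 1" using le[OF True] c by (subst le_divide_eq_1_pos) auto
        with True show ?thesis by simp
      qed simp
    qed
  qed measurable
qed

lemma finite_away:
  assumes "r > 0"
  shows "emeasure \<nu> {z. \<bar>z\<bar> > r} < \<infinity>"
  using integrable_away[OF assms] by (simp add: integrable_indicator_iff)

lemma sigma_finite: "sigma_finite_measure \<nu>"
proof
  let ?A = "\<lambda>n. {z::real. \<bar>z\<bar> > inverse (real (Suc n))}"
  show "\<exists>A. countable A \<and> A \<subseteq> sets \<nu> \<and> \<Union> A = space \<nu> \<and> (\<forall>a\<in>A. emeasure \<nu> a \<noteq> \<infinity>)"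
  proof (intro exI conjI)
    show "countable (insert {0} (range ?A))" by simp
    show "insert {0} (range ?A) \<subseteq> sets \<nu>" by auto
    have "z \<in> \<Union> (insert {0} (range ?A))" for z
    proof (cases "z = 0")
      case False
      then obtain n where "inverse (real (Suc n)) < \<bar>z\<bar>" using reals_Archimedean[of "\<bar>z\<bar>"] by auto
      then show ?thesis by blast
    qed simp
    then show "\<Union> (insert {0} (range ?A)) = space \<nu>" by auto
    show "\<forall>a\<in>insert {0} (range ?A). emeasure \<nu> a \<noteq> \<infinity>"
      using zero finite_away by (auto simp: less_top[symmetric])
  qed
qed

lemma integral_uminus:
  fixes f :: "real \<Rightarrow> real"
  assumes "f \<in> borel_measurable borel"
  shows "(LINT z|\<nu>. f (- z)) = (LINT z|\<nu>. f z)"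
  using integral_distr[of uminus \<nu> borel f] assms by (simp add: symmetric)

lemma integrable_second_diff:
  assumes [measurable]: "f \<in> borel_measurable borel" and "\<And>x z. \<bar>second_diff f x z\<bar> \<le> K * min (z\<^sup>2) 1"
  shows "integrable \<nu> (second_diff f x)"
proof (rule Bochner_Integration.integrable_bound)
  show "integrable \<nu> (\<lambda>z. K * min (z\<^sup>2) 1)" by (intro integrable_mult_right integrable_min)
  show "AE z in \<nu>. norm (second_diff f x z) \<le> norm (K * min (z\<^sup>2) 1)"
    using assms(2)[of x] by (intro always_eventually allI) (fastforce intro: order_trans)
qed measurable

text \<open>Averaging a truncated integral with its reflection turns the first difference into half
  a second difference. This is legitimate because the mass outside a neighbourhood of the origin is
  finite; afterwards domination by \<open>min (z\<^sup>2) 1\<close> lets the truncation be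
  removed.\<close>

lemma levy_integral_tendsto:
  assumes [measurable]: "f \<in> borel_measurable borel" and K: "\<And>x. \<bar>f x\<bar> \<le> K"
    and sd: "\<And>x z. \<bar>second_diff f x z\<bar> \<le> K' * min (z\<^sup>2) 1"
  shows "((\<lambda>r. set_lebesgue_integral \<nu> {z. \<bar>z\<bar> > r} (\<lambda>z. f (x + z) - f x)) \<longlongrightarrow>
    (LINT z|\<nu>. second_diff f x z) / 2) (at_right 0)"
proof -
  let ?J = "\<lambda>r. LINT z|\<nu>. indicator {z. \<bar>z\<bar> > r} z * second_diff f x z"
  have J: "set_lebesgue_integral \<nu> {z. \<bar>z\<bar> > r} (\<lambda>z. f (x + z) - f x) = ?J r / 2" if "r > 0" for r
  proof -
    let ?g = "\<lambda>z. indicator {z. \<bar>z\<bar> > r} z * (f (x + z) - f x)"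
    have g [measurable]: "?g \<in> borel_measurable borel" by measurable
    have int: "integrable \<nu> ?g" "integrable \<nu> (\<lambda>z. ?g (- z))"
    proof -
      have i: "integrable \<nu> (\<lambda>z. 2 * K * indicator {z. \<bar>z\<bar> > r} z)"
        by (intro integrable_mult_right integrable_away that)
      have b: "\<bar>f (x + z) - f x\<bar> \<le> 2 * K" for z using K[of "x + z"] K[of x] by linarith
      then have b': "\<bar>?g z\<bar> \<le> \<bar>2 * K * indicator {z. \<bar>z\<bar> > r} z\<bar>" for z
        using b[of z] by (cases "\<bar>z\<bar> > r") (auto intro: order_trans[OF b abs_ge_self])
      show "integrable \<nu> ?g"
        by (rule Bochner_Integration.integrable_bound[OF i]) (use b' in auto)
      show "integrable \<nu> (\<lambda>z. ?g (- z))"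
      proof (rule Bochner_Integration.integrable_bound[OF i])
        show "AE z in \<nu>. norm (?g (- z)) \<le> norm (2 * K * indicator {z. \<bar>z\<bar> > r} z)"
          using b'[of "- z" for z] by (intro always_eventually allI) (simp add: indicator_def)
      qed measurable
    qed
    have "2 * (LINT z|\<nu>. ?g z) = (LINT z|\<nu>. ?g z) + (LINT z|\<nu>. ?g (- z))"
      using integral_uminus[OF g] by simp
    also have "\<dots> = (LINT z|\<nu>. ?g z + ?g (- z))"
      by (rule Bochner_Integration.integral_add[symmetric]) (fact int)+
    also have "\<dots> = ?J r"
      by (intro Bochner_Integration.integral_cong) (auto simp: second_diff_def indicator_def)
    finally show ?thesis by (simp add: set_lebesgue_integral_def)
  qed
  have "(?J \<longlongrightarrow> (LINT z|\<nu>. second_diff f x z)) (at_right 0)"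
  proof (rule tendsto_at_right_sequentially[of 0 1])
    fix S :: "nat \<Rightarrow> real" assume S: "\<And>n. 0 < S n" "S \<longlonglongrightarrow> 0"
    show "(\<lambda>n. ?J (S n)) \<longlonglongrightarrow> (LINT z|\<nu>. second_diff f x z)"
    proof (rule integral_dominated_convergence[where w = "\<lambda>z. K' * min (z\<^sup>2) 1"])
      show "integrable \<nu> (\<lambda>z. K' * min (z\<^sup>2) 1)" by (intro integrable_mult_right integrable_min)
      show "AE z in \<nu>. (\<lambda>n. indicator {z. \<bar>z\<bar> > S n} z * second_diff f x z) \<longlonglongrightarrow> second_diff f x z"
      proof (intro always_eventually allI)
        fix z
        show "(\<lambda>n. indicator {z. \<bar>z\<bar> > S n} z * second_diff f x z) \<longlonglongrightarrow> second_diff f x z"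
        \<comment> \<open>The truncations never reach the origin, where the second difference
          vanishes anyway.\<close>
        proof (cases "z = 0")
          case False
          then have "\<forall>\<^sub>F n in sequentially. S n < \<bar>z\<bar>" using S(2) by (intro order_tendstoD) auto
          then have "\<forall>\<^sub>F n in sequentially. indicator {z. \<bar>z\<bar> > S n} z * second_diff f x z = second_diff f x z"
            by eventually_elim simp
          then show ?thesis by (rule tendsto_eventually)
        qed (simp add: second_diff_def)
      qed
      show "AE z in \<nu>. norm (indicator {z. \<bar>z\<bar> > S n} z * second_diff f x z) \<le> K' * min (z\<^sup>2) 1" for n
      proof (intro always_eventually allI)
        fix z
        show "norm (indicator {z. \<bar>z\<bar> > S n} z * second_diff f x z) \<le> K' * min (z\<^sup>2) 1"
          using sd[of x z] order_trans[OF abs_ge_zero sd[of x z]] by (simp add: indicator_def)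
      qed
    qed measurable
  qed simp
  then have "((\<lambda>r. ?J r / 2) \<longlongrightarrow> (LINT z|\<nu>. second_diff f x z) / 2) (at_right 0)"
    by (intro tendsto_divide tendsto_const) simp_all
  then show ?thesis
  proof (rule Lim_transform_eventually)
    show "\<forall>\<^sub>F r in at_right 0. ?J r / 2 =
        set_lebesgue_integral \<nu> {z. \<bar>z\<bar> > r} (\<lambda>z. f (x + z) - f x)"
      using eventually_at_right_less[of 0] by eventually_elim (simp add: J)
  qed
qed

lemma levy_op_eq:
  assumes "test_function \<psi>"
  shows "levy_op \<nu> \<psi> x = (LINT z|\<nu>. second_diff \<psi> x z) / 2"
proof -
  obtain K where K: "\<And>x. \<bar>\<psi> x\<bar> \<le> K" "\<And>x z. \<bar>second_diff \<psi> x z\<bar> \<le> K * z\<^sup>2"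
    unfolding second_diff_def by (rule test_function_bounds[OF assms]) blast
  show ?thesis
    unfolding levy_op_def
    by (rule tendsto_Lim[OF _ levy_integral_tendsto[OF test_function_measurable[OF assms] K(1)
          second_diff_bound[OF K]]]) simp
qed

lemma levy_op_measurable:
  assumes "test_function \<psi>"
  shows "levy_op \<nu> \<psi> \<in> borel_measurable borel"
proof -
  interpret sigma_finite_measure \<nu> by (rule sigma_finite)
  have [measurable]: "\<psi> \<in> borel_measurable borel" by (rule test_function_measurable[OF assms])
  have "(\<lambda>x. (LINT z|\<nu>. second_diff \<psi> x z) / 2) \<in> borel_measurable borel"
    unfolding second_diff_def by measurable
  moreover have "levy_op \<nu> \<psi> = (\<lambda>x. (LINT z|\<nu>. second_diff \<psi> x z) / 2)"
    by (rule ext) (rule levy_op_eq[OF assms])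
  ultimately show ?thesis by simp
qed

text \<open>The weak equation, tested with one \<open>\<psi>\<close>, becomes an equation for
  \<open>V\<close> at the point 0: Fubini moves the integration in \<open>y\<close> inside, and the
  L1 bound of \<open>pairing_bounds\<close> makes the integrand integrable on the product.\<close>

lemma integral_levy_op:
  fixes u \<psi> :: "real \<Rightarrow> real"
  assumes [measurable]: "u \<in> borel_measurable borel" and u: "\<And>x. \<bar>u x\<bar> \<le> C"
    and \<psi>: "test_function \<psi>"
  defines "V \<equiv> (\<lambda>x. LINT y|lborel. u y * \<psi> (y - x))"
  shows "(LINT y|lebesgue. u y * levy_op \<nu> \<psi> y) = (LINT z|\<nu>. second_diff V 0 z) / 2"
proof -
  interpret sigma_finite_measure \<nu> by (rule sigma_finite)
  interpret pair_sigma_finite \<nu> "lborel :: real measure" ..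
  have [measurable]: "\<psi> \<in> borel_measurable borel" by (rule test_function_measurable[OF \<psi>])
  obtain B where
    B: "\<And>x z. integrable lborel (\<lambda>y. u y * second_diff \<psi> (y - x) z)"
      "\<And>x z. (LINT y|lborel. u y * second_diff \<psi> (y - x) z) = second_diff V x z"
      "\<And>x z. (LINT y|lborel. \<bar>u y * second_diff \<psi> (y - x) z\<bar>) \<le> B * min (z\<^sup>2) 1"
    unfolding V_def by (rule pairing_bounds[OF assms(1-3)]) blast
  let ?f = "\<lambda>z y. u y * second_diff \<psi> y z"
  have int: "integrable (\<nu> \<Otimes>\<^sub>M lborel) (case_prod ?f)"
  proof (rule Fubini_integrable)
    show [measurable]: "case_prod ?f \<in> borel_measurable (\<nu> \<Otimes>\<^sub>M lborel)"
      unfolding second_diff_def by measurable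
    have "integrable \<nu> (\<lambda>z. B * min (z\<^sup>2) 1)" by (intro integrable_mult_right integrable_min)
    then show "integrable \<nu> (\<lambda>z. LINT y|lborel. norm (case_prod ?f (z, y)))"
    proof (rule Bochner_Integration.integrable_bound)
      show "AE z in \<nu>. norm (LINT y|lborel. norm (case_prod ?f (z, y))) \<le> norm (B * min (z\<^sup>2) 1)"
        using B(3)[of 0] by (intro always_eventually allI) (fastforce intro: order_trans)
    qed measurable
    show "AE z in \<nu>. integrable lborel (\<lambda>y. case_prod ?f (z, y))"
      using B(1)[of 0] by simp
  qed
  have "(LINT y|lebesgue. u y * levy_op \<nu> \<psi> y) = (LINT y|lebesgue. (LINT z|\<nu>. ?f z y) / 2)"
    by (simp add: levy_op_eq[OF \<psi>])
  also have "\<dots> = (LINT y|lborel. (LINT z|\<nu>. ?f z y) / 2)"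
    by (rule integral_completion) (simp add: second_diff_def)
  also have "\<dots> = (LINT y|lborel. (LINT z|\<nu>. ?f z y)) / 2" by simp
  also have "(LINT y|lborel. (LINT z|\<nu>. ?f z y)) = (LINT z|\<nu>. (LINT y|lborel. ?f z y))"
    by (rule Fubini_integral[OF int])
  also have "\<dots> = (LINT z|\<nu>. second_diff V 0 z)"
    using B(2)[of 0] by simp
  finally show ?thesis .
qed

end

section \<open>Maximum principle and periods\<close>

lemma second_diff_uminus: "second_diff (\<lambda>x. - f x) x z = - second_diff f x z"
  by (simp add: second_diff_def)

lemma second_diff_increment:
  "second_diff (\<lambda>x. f (x + a) - f x) x z = second_diff f (x + a) z - second_diff f x z"
  by (simp add: second_diff_def algebra_simps)

context symmetric_levy
begin

text \<open>
  At a near-maximum of \<open>W\<close> the second differences are nearly nonpositive. As they average to zero,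
  they cannot be very negative on a set of positive measure.
\<close>

lemma near_maximum_step:
  fixes W :: "real \<Rightarrow> real"
  assumes cont: "uniformly_continuous_on UNIV W"
    and sd: "\<And>x z. \<bar>second_diff W x z\<bar> \<le> K * min (z\<^sup>2) 1"
    and harmonic: "\<And>x. (LINT z|\<nu>. second_diff W x z) = 0"
    and M: "\<And>x. W x \<le> M"
    and "a \<noteq> 0" and charge: "\<And>r. r > 0 \<Longrightarrow> emeasure \<nu> (ball a r) > 0" and "\<epsilon> > 0"
  shows "\<exists>\<delta>>0. \<forall>x. W x \<ge> M - \<delta> \<longrightarrow> W (x + a) \<ge> M - \<epsilon>"
proof -
  have [measurable]: "W \<in> borel_measurable borel"
    by (intro borel_measurable_continuous_onI uniformly_continuous_imp_continuous cont)
  have K: "K \<ge> 0" using sd[of 0 1] by simp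
  obtain r0 where "r0 > 0" and r0: "\<And>x y. dist y x < r0 \<Longrightarrow> dist (W y) (W x) < \<epsilon> / 2"
    using cont \<open>\<epsilon> > 0\<close> unfolding uniformly_continuous_on_def by (metis UNIV_I half_gt_zero)
  \<comment> \<open>The bound \<open>r0\<close> keeps \<open>W\<close> within
    \<open>\<epsilon> / 2\<close> of its value at \<open>x + a\<close>; the bound
    \<open>\<bar>a\<bar> / 2\<close> keeps the ball off the origin and hence of finite
    measure.\<close>
  define r where "r = min r0 (\<bar>a\<bar> / 2)"
  have r: "r > 0" "r \<le> r0" "r \<le> \<bar>a\<bar> / 2" using \<open>r0 > 0\<close> \<open>a \<noteq> 0\<close> by (auto simp: r_def)
  have "emeasure \<nu> (ball a r) \<le> emeasure \<nu> {z. \<bar>z\<bar> > \<bar>a\<bar> / 2}"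
    using r by (intro emeasure_mono) (auto simp: dist_real_def)
  also have "\<dots> < \<infinity>" using \<open>a \<noteq> 0\<close> by (intro finite_away) simp
  finally have fin: "emeasure \<nu> (ball a r) < \<infinity>" .
  define m where "m = measure \<nu> (ball a r)"
  have m: "m > 0"
    using charge[OF r(1)] fin unfolding m_def measure_def by (simp add: enn2real_positive_iff)
  \<comment> \<open>This dominates the second differences at any \<open>x\<close> with
    \<open>W x \<ge> M - \<delta>\<close>. The bound \<open>2 * \<delta>\<close> alone may fail to
    be integrable, as the measure may be infinite; the minimum is integrable, and its integral tends
    to 0 with \<open>\<delta>\<close>.\<close>
  let ?G = "\<lambda>\<delta> z. min (2 * \<delta>) (K * min (z\<^sup>2) 1)"
  have intG: "integrable \<nu> (?G \<delta>)" if "\<delta> > 0" for \<delta>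
  proof (rule Bochner_Integration.integrable_bound)
    show "integrable \<nu> (\<lambda>z. K * min (z\<^sup>2) 1)" by (intro integrable_mult_right integrable_min)
    show "AE z in \<nu>. norm (?G \<delta> z) \<le> norm (K * min (z\<^sup>2) 1)"
      using K that by (intro always_eventually allI) (simp add: abs_mult min_def)
  qed measurable
  have "(\<lambda>n. LINT z|\<nu>. ?G (inverse (real (Suc n))) z) \<longlonglongrightarrow> (LINT z|\<nu>. 0)"
  proof (rule integral_dominated_convergence[where w = "\<lambda>z. K * min (z\<^sup>2) 1"])
    show "integrable \<nu> (\<lambda>z. K * min (z\<^sup>2) 1)" by (intro integrable_mult_right integrable_min)
    show "AE z in \<nu>. (\<lambda>n. ?G (inverse (real (Suc n))) z) \<longlonglongrightarrow> 0"
    proof (intro always_eventually allI)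
      fix z :: real
      have "(\<lambda>n. ?G (inverse (real (Suc n))) z) \<longlonglongrightarrow> min (2 * 0) (K * min (z\<^sup>2) 1)"
        by (intro tendsto_min tendsto_mult tendsto_const LIMSEQ_inverse_real_of_nat)
      then show "(\<lambda>n. ?G (inverse (real (Suc n))) z) \<longlonglongrightarrow> 0" using K by simp
    qed
    show "AE z in \<nu>. norm (?G (inverse (real (Suc n))) z) \<le> K * min (z\<^sup>2) 1" for n
      using K by (intro always_eventually allI) (simp add: abs_mult min_def)
  qed measurable
  \<comment> \<open>With \<open>\<delta> < \<epsilon> / 8\<close>, the ball contributes at most -
    \<epsilon>/4 times its mass \<open>m\<close>; the remainder must therefore stay below
    \<open>m * \<epsilon> / 4\<close> to make the total negative.\<close>
  then have "\<forall>\<^sub>F n in sequentially. (LINT z|\<nu>. ?G (inverse (real (Suc n))) z) < m * \<epsilon> / 4"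
    using m \<open>\<epsilon> > 0\<close> by (intro order_tendstoD) auto
  moreover have "\<forall>\<^sub>F n in sequentially. inverse (real (Suc n)) < \<epsilon> / 8"
    using LIMSEQ_inverse_real_of_nat \<open>\<epsilon> > 0\<close> by (intro order_tendstoD(2)) auto
  ultimately have "\<forall>\<^sub>F n in sequentially. (LINT z|\<nu>. ?G (inverse (real (Suc n))) z) < m * \<epsilon> / 4
      \<and> inverse (real (Suc n)) < \<epsilon> / 8"
    by (rule eventually_conj)
  then obtain n where n: "(LINT z|\<nu>. ?G (inverse (real (Suc n))) z) < m * \<epsilon> / 4"
      "inverse (real (Suc n)) < \<epsilon> / 8"
    unfolding eventually_sequentially by blast
  define \<delta> where "\<delta> = inverse (real (Suc n))"
  have \<delta>: "\<delta> > 0" "\<delta> < \<epsilon> / 8" "(LINT z|\<nu>. ?G \<delta> z) < m * \<epsilon> / 4"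
    using n by (simp_all add: \<delta>_def)
  have "W (x + a) \<ge> M - \<epsilon>" if x: "W x \<ge> M - \<delta>" for x
  proof (rule ccontr)
    assume "\<not> W (x + a) \<ge> M - \<epsilon>"
    then have xa: "W (x + a) < M - \<epsilon>" by simp
    have ball: "integrable \<nu> (\<lambda>z. (2 * \<delta> - \<epsilon> / 2) * indicator (ball a r) z)"
      using fin by (intro integrable_mult_right) (simp add: integrable_indicator_iff)
    have le: "second_diff W x z \<le> ?G \<delta> z + (2 * \<delta> - \<epsilon> / 2) * indicator (ball a r) z" for z
    proof (cases "z \<in> ball a r")
      case True
      then have "dist (x + z) (x + a) < r0" using r by (simp add: dist_commute)
      then have "W (x + z) < M - \<epsilon> / 2" using r0[of "x + z" "x + a"] xa unfolding dist_real_def by linarith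
      then have "second_diff W x z \<le> 2 * \<delta> - \<epsilon> / 2"
        unfolding second_diff_def using M[of "x - z"] x by linarith
      moreover have "?G \<delta> z \<ge> 0" using K \<delta>(1) by simp
      ultimately show ?thesis using True by (simp only: indicator_simps mult_1_right)
    next
      case False
      have "second_diff W x z \<le> 2 * \<delta>"
        unfolding second_diff_def using M[of "x - z"] M[of "x + z"] x by linarith
      moreover have "second_diff W x z \<le> K * min (z\<^sup>2) 1" using sd[of x z] by linarith
      ultimately show ?thesis using False by simp
    qed
    have "0 = (LINT z|\<nu>. second_diff W x z)" using harmonic[of x] by simp
    also have "\<dots> \<le> (LINT z|\<nu>. ?G \<delta> z + (2 * \<delta> - \<epsilon> / 2) * indicator (ball a r) z)"
      by (intro integral_mono integrable_second_diff[OF _ sd] Bochner_Integration.integrable_add intG \<delta> ball le)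
        measurable
    also have "\<dots> = (LINT z|\<nu>. ?G \<delta> z) + (2 * \<delta> - \<epsilon> / 2) * m"
      using intG[OF \<delta>(1)] ball by (subst Bochner_Integration.integral_add) (auto simp: m_def)
    also have "\<dots> < m * \<epsilon> / 4 + (- \<epsilon> / 4) * m"
      using \<delta> m by (intro add_less_le_mono mult_right_mono) auto
    finally show False by simp
  qed
  with \<delta>(1) show ?thesis by blast
qed

text \<open>The number of steps is fixed in advance, so the tolerances can be chosen backwards from
  \<open>\<epsilon>\<close>, one for each step.\<close>

lemma near_maximum_iterate:
  fixes W :: "real \<Rightarrow> real"
  assumes W: "uniformly_continuous_on UNIV W"
      "\<And>x z. \<bar>second_diff W x z\<bar> \<le> K * min (z\<^sup>2) 1"
      "\<And>x. (LINT z|\<nu>. second_diff W x z) = 0"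
      "\<And>x. W x \<le> M"
    and a: "a \<noteq> 0" "\<And>r. r > 0 \<Longrightarrow> emeasure \<nu> (ball a r) > 0" and "\<epsilon> > 0"
  shows "\<exists>\<delta>>0. \<forall>x. W x \<ge> M - \<delta> \<longrightarrow> (\<forall>j\<le>k. W (x + real j * a) \<ge> M - \<epsilon>)"
  using \<open>\<epsilon> > 0\<close>
proof (induction k arbitrary: \<epsilon>)
  case 0
  then show ?case by auto
next
  case (Suc k)
  obtain \<delta>1 where \<delta>1: "\<delta>1 > 0" "\<And>x. W x \<ge> M - \<delta>1 \<Longrightarrow> W (x + a) \<ge> M - \<epsilon>"
    using near_maximum_step[OF W a Suc.prems] by blast
  \<comment> \<open>The first \<open>k\<close> steps must respect \<open>\<epsilon>\<close>
    everywhere and also end within \<open>\<delta>1\<close>, so that one further step is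
    possible.\<close>
  have "min \<delta>1 \<epsilon> > 0" using \<delta>1 Suc.prems by simp
  from Suc.IH[OF this] obtain \<delta> where \<delta>: "\<delta> > 0"
      "\<And>x j. W x \<ge> M - \<delta> \<Longrightarrow> j \<le> k \<Longrightarrow> W (x + real j * a) \<ge> M - min \<delta>1 \<epsilon>"
    by blast
  have "W (x + real j * a) \<ge> M - \<epsilon>" if x: "W x \<ge> M - \<delta>" and j: "j \<le> Suc k" for x j
  proof (cases "j \<le> k")
    case True
    then show ?thesis using \<delta>(2)[OF x True] by linarith
  next
    case False
    then have j: "j = Suc k" using j by simp
    have "W (x + real k * a) \<ge> M - \<delta>1" using \<delta>(2)[OF x, of k] by linarith
    from \<delta>1(2)[OF this] show ?thesis by (simp add: j algebra_simps)
  qed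
  with \<delta>(1) show ?case by blast
qed

text \<open>
  If the increment \<open>V (x + a) - V x\<close> had a positive supremum, then it would stay close to it along
  an arbitrarily long progression \<open>x, x + a, x + 2 a, \<dots>\<close>, and \<open>V\<close> would be unbounded.
\<close>

lemma increment_le:
  fixes V :: "real \<Rightarrow> real"
  assumes cont: "uniformly_continuous_on UNIV V"
    and sd: "\<And>x z. \<bar>second_diff V x z\<bar> \<le> K * min (z\<^sup>2) 1"
    and harmonic: "\<And>x. (LINT z|\<nu>. second_diff V x z) = 0"
    and bound: "\<And>x. \<bar>V x\<bar> \<le> B"
    and a: "a \<noteq> 0" "\<And>r. r > 0 \<Longrightarrow> emeasure \<nu> (ball a r) > 0"
  shows "V (x + a) \<le> V x"
proof (rule ccontr)
  assume pos: "\<not> V (x + a) \<le> V x"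
  define W where "W = (\<lambda>x. V (x + a) - V x)"
  have [measurable]: "V \<in> borel_measurable borel"
    by (intro borel_measurable_continuous_onI uniformly_continuous_imp_continuous cont)
  have int: "integrable \<nu> (second_diff V x)" for x
    by (rule integrable_second_diff[OF _ sd]) measurable
  have "uniformly_continuous_on UNIV (\<lambda>x. V (x + a))"
    unfolding uniformly_continuous_on_def
  proof (intro allI impI)
    fix e :: real assume "e > 0"
    then obtain d where "d > 0" "\<And>x y. dist y x < d \<Longrightarrow> dist (V y) (V x) < e"
      using cont unfolding uniformly_continuous_on_def by (metis UNIV_I)
    then show "\<exists>d>0. \<forall>x\<in>UNIV. \<forall>x'\<in>UNIV. dist x' x < d \<longrightarrow> dist (V (x' + a)) (V (x + a)) < e"
      by (intro exI[of _ d]) auto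
  qed
  then have W1: "uniformly_continuous_on UNIV W"
    unfolding W_def by (intro uniformly_continuous_on_diff cont)
  have W2: "\<bar>second_diff W x z\<bar> \<le> (2 * K) * min (z\<^sup>2) 1" for x z
    unfolding W_def second_diff_increment using sd[of "x + a" z] sd[of x z] by linarith
  have W3: "(LINT z|\<nu>. second_diff W x z) = 0" for x
    unfolding W_def second_diff_increment
    using harmonic int by (subst Bochner_Integration.integral_diff) auto
  have Wb: "W x \<le> 2 * B" for x
    unfolding W_def using bound[of "x + a"] bound[of x] by linarith
  define M where "M = (SUP x. W x)"
  have bdd: "bdd_above (range W)" using Wb by (intro bdd_aboveI2)
  have W4: "W x \<le> M" for x unfolding M_def using bdd by (intro cSUP_upper) auto
  have M: "M > 0" using W4[of x] pos by (simp add: W_def)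
  \<comment> \<open>Increments of at least \<open>M / 2\<close> along \<open>k\<close> steps raise
    \<open>V\<close> by more than \<open>2 * B\<close>, the largest oscillation that its bound
    allows.\<close>
  then obtain k where k: "2 * B < real k * (M / 2)"
    using reals_Archimedean3[of "M / 2"] half_gt_zero by blast
  obtain \<delta> where \<delta>: "\<delta> > 0"
      "\<And>x j. W x \<ge> M - \<delta> \<Longrightarrow> j \<le> k \<Longrightarrow> W (x + real j * a) \<ge> M - M / 2"
    using near_maximum_iterate[OF W1 W2 W3 W4 a, of "M / 2" k] M by auto
  have "M - \<delta> < (SUP x. W x)" using \<delta>(1) by (simp add: M_def)
  then obtain y where y: "W y \<ge> M - \<delta>"
    using less_cSUP_iff[OF _ bdd, of "M - \<delta>"] less_imp_le by blast
  have "V (y + real j * a) \<ge> V y + real j * (M / 2)" if "j \<le> k" for j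
    using that
  proof (induction j)
    case (Suc j)
    have "V (y + real (Suc j) * a) = V (y + real j * a) + W (y + real j * a)"
      by (simp add: W_def algebra_simps)
    moreover have "V (y + real j * a) \<ge> V y + real j * (M / 2)" using Suc by simp
    moreover have "W (y + real j * a) \<ge> M - M / 2" using \<delta>(2)[OF y, of j] Suc.prems by simp
    moreover have "real (Suc j) * (M / 2) = real j * (M / 2) + M / 2" by (simp add: algebra_simps)
    ultimately show ?case by linarith
  qed simp
  from this[of k] k bound[of y] bound[of "y + real k * a"] show False by linarith
qed

text \<open>The inequality for increments is one-sided; \<open>- V\<close> satisfies the same
  hypotheses and supplies the reverse one.\<close>

lemma charge_is_period:
  fixes V :: "real \<Rightarrow> real"
  assumes cont: "uniformly_continuous_on UNIV V"
    and sd: "\<And>x z. \<bar>second_diff V x z\<bar> \<le> K * min (z\<^sup>2) 1"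
    and harmonic: "\<And>x. (LINT z|\<nu>. second_diff V x z) = 0"
    and bound: "\<And>x. \<bar>V x\<bar> \<le> B"
    and a: "a \<noteq> 0" "\<And>r. r > 0 \<Longrightarrow> emeasure \<nu> (ball a r) > 0"
  shows "V (x + a) = V x"
proof -
  have "V (x + a) \<le> V x" by (rule increment_le[OF assms])
  moreover have "- V (x + a) \<le> - V x"
    by (rule increment_le[of "\<lambda>x. - V x" K B a x])
      (use sd harmonic bound a in \<open>auto simp: second_diff_uminus intro!: uniformly_continuous_on_minus cont\<close>)
  ultimately show ?thesis by simp
qed

text \<open>The topological support with the origin removed; the origin itself may be a limit of
  charged points.\<close>

definition charged :: "real set" where
  "charged = {z. z \<noteq> 0 \<and> (\<forall>r>0. emeasure \<nu> (ball z r) > 0)}"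

text \<open>The complement of the support is covered by null balls, possibly uncountably many;
  Lindelof extracts a countable subcover.\<close>

lemma AE_charged: "AE z in \<nu>. z = 0 \<or> z \<in> charged"
proof -
  let ?F = "{ball z r |z r. r > 0 \<and> emeasure \<nu> (ball z r) = 0}"
  obtain F where F: "F \<subseteq> ?F" "countable F" "\<Union> F = \<Union> ?F"
    using Lindelof[of ?F] by auto
  have "A \<in> null_sets \<nu>" if "A \<in> F" for A using that F(1) by (auto simp: null_sets_def)
  then have "\<Union> F \<in> null_sets \<nu>" using null_sets_UN'[OF F(2), of id] by simp
  moreover have "{0} \<in> null_sets \<nu>" using zero by (simp add: null_sets_def)
  ultimately have "\<Union> F \<union> {0} \<in> null_sets \<nu>" by (rule null_sets.Un)
  then show ?thesis
  proof (rule AE_I')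
    show "{z \<in> space \<nu>. \<not> (z = 0 \<or> z \<in> charged)} \<subseteq> \<Union> F \<union> {0}"
    proof
      fix z assume "z \<in> {z \<in> space \<nu>. \<not> (z = 0 \<or> z \<in> charged)}"
      then obtain r where "r > 0" "emeasure \<nu> (ball z r) = 0"
        by (auto simp: charged_def not_less)
      then have "z \<in> \<Union> ?F" by force
      then show "z \<in> \<Union> F \<union> {0}" using F(3) by simp
    qed
  qed
qed

text \<open>The group theory of periods enters only through \<open>gen\<close>, which keeps it apart
  from the analysis. Constancy of \<open>V\<close> for every \<open>\<phi>\<close> is exactly
  translation invariance of the pairings with \<open>u\<close>.\<close>

lemma AE_constant_if_solution:
  fixes u :: "real \<Rightarrow> real"
  assumes [measurable]: "u \<in> borel_measurable borel" and u: "\<And>x. \<bar>u x\<bar> \<le> C"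
    and sol: "distributional_solution \<nu> u"
    and gen: "\<And>f x. continuous_on UNIV f \<Longrightarrow> (\<And>a x. a \<in> charged \<Longrightarrow> f (x + a) = f x) \<Longrightarrow> f x = (f 0 :: real)"
  shows "\<exists>c. AE x in lborel. u x = c"
proof (rule AE_constant_if_translation_invariant[OF assms(1) u])
  fix \<phi> :: "real \<Rightarrow> real" and x :: real
  assume \<phi>: "test_function \<phi>"
  define V where "V x = (LINT y|lborel. u y * \<phi> (y - x))" for x
  obtain B where B: "\<And>x. \<bar>V x\<bar> \<le> B" "\<And>x h. \<bar>h\<bar> \<le> 1 \<Longrightarrow> \<bar>V (x + h) - V x\<bar> \<le> B * \<bar>h\<bar>"
    "\<And>x z. (LINT y|lborel. u y * second_diff \<phi> (y - x) z) = second_diff V x z"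
    "\<And>x z. (LINT y|lborel. \<bar>u y * second_diff \<phi> (y - x) z\<bar>) \<le> B * min (z\<^sup>2) 1"
    unfolding V_def by (rule pairing_bounds[OF assms(1) u \<phi>]) blast
  have sd: "\<bar>second_diff V x z\<bar> \<le> B * min (z\<^sup>2) 1" for x z
    using B(3)[of x z] B(4)[of x z]
      integral_abs_bound[of lborel "\<lambda>y. u y * second_diff \<phi> (y - x) z"] by linarith
  have cont: "uniformly_continuous_on UNIV V"
    unfolding uniformly_continuous_on_def
  proof (intro allI impI)
    fix e :: real assume e: "e > 0"
    have B0: "B \<ge> 0" using B(1)[of 0] by linarith
    \<comment> \<open>The minimum with 1 is there because the Lipschitz estimate holds for steps of
      length at most 1; \<open>B + 1\<close> keeps the divisor positive.\<close>
    define d where "d = min 1 (e / (B + 1))"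
    have d: "d > 0" using e B0 by (simp add: d_def)
    have "dist (V y) (V x) < e" if "dist y x < d" for x y
    proof -
      have h: "\<bar>y - x\<bar> \<le> 1" "\<bar>y - x\<bar> < e / (B + 1)" using that by (auto simp: dist_real_def d_def)
      have "\<bar>V y - V x\<bar> \<le> B * \<bar>y - x\<bar>" using B(2)[OF h(1), of x] by simp
      also have "\<dots> \<le> (B + 1) * \<bar>y - x\<bar>" by (simp add: algebra_simps)
      also have "\<dots> < e" using h(2) B0 by (simp add: field_simps)
      finally show ?thesis by (simp add: dist_real_def)
    qed
    with d show "\<exists>d>0. \<forall>x\<in>UNIV. \<forall>x'\<in>UNIV. dist x' x < d \<longrightarrow> dist (V x') (V x) < e" by blast
  qed
  have harmonic: "(LINT z|\<nu>. second_diff V x z) = 0" for x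
  proof -
    \<comment> \<open>\<open>integral_levy_op\<close> concerns the point 0 only; testing with the
      translate of \<open>\<phi>\<close> moves the equation to \<open>x\<close>.\<close>
    have \<phi>x: "test_function (\<lambda>y. \<phi> (y - x))" by (rule test_function_shift[OF \<phi>])
    have "second_diff (\<lambda>t. LINT y|lborel. u y * \<phi> (y - t - x)) 0 z = second_diff V x z" for z
      by (simp add: second_diff_def V_def algebra_simps)
    then have "(LINT y|lebesgue. u y * levy_op \<nu> (\<lambda>y. \<phi> (y - x)) y) = (LINT z|\<nu>. second_diff V x z) / 2"
      using integral_levy_op[OF assms(1) u \<phi>x] by simp
    then show ?thesis using sol \<phi>x by (simp add: distributional_solution_def)
  qed
  have "V x = V 0"
  proof (rule gen)
    show "continuous_on UNIV V" by (rule uniformly_continuous_imp_continuous[OF cont])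
    show "V (x + a) = V x" if "a \<in> charged" for a x
      by (rule charge_is_period[OF cont sd harmonic B(1)]) (use that in \<open>auto simp: charged_def\<close>)
  qed
  then show "(LINT y|lborel. u y * \<phi> (y - x)) = (LINT y|lborel. u y * \<phi> y)" by (simp add: V_def)
qed

text \<open>After a change of variables \<open>V\<close> inherits the period \<open>d\<close> of the
  cosine, so its second difference at 0 vanishes at every charged point, hence almost everywhere for
  the measure.\<close>

lemma distributional_solution_cos:
  assumes "d > 0" and lattice: "charged \<subseteq> range (\<lambda>k::int. of_int k * d)"
  shows "distributional_solution \<nu> (\<lambda>x. cos (2 * pi / d * x))"
  unfolding distributional_solution_def
proof (intro allI impI)
  let ?u = "\<lambda>x. cos (2 * pi / d * x)"
  fix \<psi> assume \<psi>: "test_function \<psi>"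
  have [measurable]: "\<psi> \<in> borel_measurable borel" by (rule test_function_measurable[OF \<psi>])
  define V where "V x = (LINT y|lborel. ?u y * \<psi> (y - x))" for x
  have V: "V x = (LINT y|lborel. ?u (x + y) * \<psi> y)" for x
    unfolding V_def by (subst lborel_integral_real_affine[where c = 1 and t = x]) auto
  have u: "?u (of_int k * d + y) = ?u y" for k y
  proof -
    have "2 * pi / d * (of_int k * d + y) = 2 * pi * of_int k + 2 * pi / d * y"
      using \<open>d > 0\<close> by (simp add: field_simps)
    then show ?thesis by (simp only: cos_add cos_int_2pin sin_int_2pin mult_1 mult_zero_left diff_0_right)
  qed
  have Vk: "V (of_int k * d) = V 0" for k unfolding V u by simp
  have "second_diff V 0 z = 0" if "z = 0 \<or> z \<in> charged" for z
  proof -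
    from that lattice obtain k :: int where "z = of_int k * d"
      by (auto intro: that[of 0])
    then show ?thesis using Vk[of k] Vk[of "- k"] by (simp add: second_diff_def)
  qed
  then have "AE z in \<nu>. second_diff V 0 z = 0"
    using AE_charged by (auto elim!: eventually_mono)
  then have "(LINT z|\<nu>. second_diff V 0 z) = 0" by (rule integral_eq_zero_AE)
  moreover have "?u \<in> borel_measurable borel"
    by (intro borel_measurable_continuous_onI continuous_intros)
  then have "(LINT y|lebesgue. ?u y * levy_op \<nu> \<psi> y) = (LINT z|\<nu>. second_diff V 0 z) / 2"
    unfolding V_def by (rule integral_levy_op[OF _ _ \<psi>, where C = 1]) simp
  ultimately show "(LINT y|lebesgue. ?u y * levy_op \<nu> \<psi> y) = 0" by simp
qed

end

section \<open>Supports contained in a lattice\<close>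

text \<open>The empty set qualifies, in accordance with the zero measure, for which every bounded
  function is a solution.\<close>

definition in_lattice :: "real set \<Rightarrow> bool" where
  "in_lattice S \<longleftrightarrow> (\<exists>d>0. S \<subseteq> range (\<lambda>k::int. of_int k * d))"

text \<open>Multiples of a period \<open>p\<close> come within \<open>p\<close> of any
  \<open>x\<close>, and \<open>f\<close> takes the value \<open>f 0\<close> there.\<close>

lemma constant_if_small_periods:
  fixes f :: "real \<Rightarrow> real"
  assumes cont: "continuous_on UNIV f"
    and small: "\<And>e. e > 0 \<Longrightarrow> \<exists>p. 0 < p \<and> p < e \<and> (\<forall>x. f (x + p) = f x)"
  shows "f x = f 0"
proof (rule ccontr)
  assume "f x \<noteq> f 0"
  then have "dist (f 0) (f x) > 0" by simp
  then obtain d where d: "d > 0" "\<And>y. dist y x < d \<Longrightarrow> dist (f y) (f x) < dist (f 0) (f x)"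
    using cont unfolding continuous_on_iff by (metis UNIV_I)
  obtain p where p: "0 < p" "p < d" "\<And>x. f (x + p) = f x" using small[OF d(1)] by blast
  have nat: "f (y + real n * p) = f y" for y n
  proof (induction n)
    case (Suc n)
    have "f (y + real (Suc n) * p) = f (y + real n * p + p)" by (simp add: algebra_simps)
    then show ?case using p(3) Suc by simp
  qed simp
  have int: "f (of_int k * p) = f 0" for k
  proof (cases "k \<ge> 0")
    case True
    then show ?thesis using nat[of 0 "nat k"] by simp
  next
    case False
    then show ?thesis using nat[of "of_int k * p" "nat (- k)"] by (simp add: algebra_simps)
  qed
  define k where "k = \<lfloor>x / p\<rfloor>"
  have "of_int k * p \<le> x" "x < (of_int k + 1) * p"
    using p(1) floor_divide_lower[of p x] floor_divide_upper[of p x] by (auto simp: k_def)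
  then have "dist (of_int k * p) x < d" using p(2) by (auto simp: dist_real_def algebra_simps)
  from d(2)[OF this] show False using int by simp
qed

text \<open>The periods form a subgroup of the reals with a gap of length \<open>e\<close> to the
  right of 0. Such a subgroup is cyclic: it has a least positive element unless trivial, and
  division with remainder does the rest.\<close>

lemma discrete_periods_lattice:
  fixes f :: "real \<Rightarrow> real"
  assumes e: "e > 0" "\<And>p. 0 < p \<Longrightarrow> p < e \<Longrightarrow> \<exists>x. f (x + p) \<noteq> f x"
  shows "in_lattice {p. \<forall>x. f (x + p) = f x}"
proof -
  define P where "P = {p. \<forall>x. f (x + p) = f x}"
  have small: "\<not> p < e" if "p \<in> P" "0 < p" for p using e(2)[of p] that by (auto simp: P_def)
  have minus: "- p \<in> P" if "p \<in> P" for p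
    unfolding P_def
  proof (intro CollectI allI)
    fix x
    have "f (x + - p + p) = f (x + - p)" using that unfolding P_def by blast
    then show "f (x + - p) = f x" by simp
  qed
  have add: "p + q \<in> P" if "p \<in> P" "q \<in> P" for p q
    using that by (simp add: P_def add.assoc[symmetric])
  have nat: "real n * p \<in> P" if "p \<in> P" for n p
  proof (induction n)
    case (Suc n)
    then show ?case using add[OF that Suc] by (simp add: algebra_simps)
  qed (simp add: P_def)
  have int: "of_int k * p \<in> P" if "p \<in> P" for k p
  proof (cases "k \<ge> 0")
    case True
    then show ?thesis using nat[OF that, of "nat k"] by simp
  next
    case False
    then show ?thesis using minus[OF nat[OF that, of "nat (- k)"]] by simp
  qed
  show ?thesis
  proof (cases "\<exists>p\<in>P. p > 0")
    case True
    let ?Q = "{p \<in> P. p > 0}"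
    have bdd: "bdd_below ?Q" by (rule bdd_belowI[of _ 0]) auto
    \<comment> \<open>A period \<open>p\<close> within \<open>e\<close> of the infimum is already
      the least positive one: a smaller positive \<open>q\<close> would make \<open>p - q\<close> a
      positive period below \<open>e\<close>.\<close>
    have "Inf ?Q < Inf ?Q + e" using e(1) by simp
    then obtain p where p: "p \<in> P" "p > 0" "p < Inf ?Q + e"
      using cInf_lessD[of ?Q "Inf ?Q + e"] True by blast
    have min: "\<not> q < p" if "q \<in> P" "q > 0" for q
    proof
      assume "q < p"
      have "Inf ?Q \<le> q" using that by (intro cInf_lower bdd) auto
      then have "p - q < e" using p(3) by simp
      moreover have "p - q \<in> P" using add[OF p(1) minus[OF that(1)]] by simp
      ultimately show False using small[of "p - q"] \<open>q < p\<close> by simp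
    qed
    have "q \<in> range (\<lambda>k::int. of_int k * p)" if q: "q \<in> P" for q
    proof -
      define k where "k = \<lfloor>q / p\<rfloor>"
      have *: "of_int k * p \<le> q" "q < (of_int k + 1) * p"
        using p(2) floor_divide_lower[of p q] floor_divide_upper[of p q] by (auto simp: k_def)
      have "q - of_int k * p \<in> P" using add[OF q minus[OF int[OF p(1), of k]]] by simp
      moreover have "q - of_int k * p < p" using * by (simp add: algebra_simps)
      ultimately have "\<not> q - of_int k * p > 0" using min by blast
      with * have "q = of_int k * p" by simp
      then show ?thesis by blast
    qed
    then show ?thesis using p(2) unfolding in_lattice_def P_def by blast
  next
    case False
    have "p = 0" if "p \<in> P" for p
      using False minus[OF that] that by (metis neg_0_less_iff_less not_less_iff_gr_or_eq)
    then have "P \<subseteq> range (\<lambda>k::int. of_int k * 1)" by (auto intro: range_eqI[of _ _ 0])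
    then show ?thesis unfolding in_lattice_def P_def by (intro exI[of _ 1]) auto
  qed
qed

lemma constant_or_in_lattice:
  fixes f :: "real \<Rightarrow> real"
  assumes "\<not> in_lattice S" "continuous_on UNIV f" "\<And>a x. a \<in> S \<Longrightarrow> f (x + a) = f x"
  shows "f x = f 0"
proof (rule constant_if_small_periods[OF assms(2)])
  fix e :: real assume "e > 0"
  show "\<exists>p. 0 < p \<and> p < e \<and> (\<forall>x. f (x + p) = f x)"
  proof (rule ccontr)
    assume "\<not> ?thesis"
    then have "in_lattice {p. \<forall>x. f (x + p) = f x}"
      by (intro discrete_periods_lattice[OF \<open>e > 0\<close>]) blast
    moreover have "S \<subseteq> {p. \<forall>x. f (x + p) = f x}" using assms(3) by blast
    ultimately show False using assms(1) unfolding in_lattice_def by (meson order_trans)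
  qed
qed

section \<open>The lattice criterion on the whole line\<close>

lemma L_infinity_borel_representative:
  assumes "L_infinity u"
  obtains g C where "g \<in> borel_measurable borel" "\<And>x. \<bar>g x\<bar> \<le> C" "AE x in lborel. u x = g x"
proof -
  obtain C where u: "u \<in> borel_measurable lebesgue" and C: "AE x in lebesgue. \<bar>u x\<bar> \<le> C"
    using assms by (auto simp: L_infinity_def)
  obtain h where h: "h \<in> borel_measurable lborel" "AE x in lborel. u x = h x"
    using completion_ex_borel_measurable_real[OF u] by blast
  \<comment> \<open>Truncation turns the almost-everywhere bound into one at every point;
    \<open>\<bar>C\<bar>\<close> spares showing that \<open>C\<close> is nonnegative.\<close>
  define g where "g x = max (- \<bar>C\<bar>) (min \<bar>C\<bar> (h x))" for x
  have [measurable]: "h \<in> borel_measurable borel" using h(1) by simp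
  show thesis
  proof (rule that[of g "\<bar>C\<bar>"])
    show "g \<in> borel_measurable borel" unfolding g_def by measurable
    show "\<bar>g x\<bar> \<le> \<bar>C\<bar>" for x by (auto simp: g_def)
    have "AE x in lborel. \<bar>u x\<bar> \<le> C" using C by (simp add: AE_completion_iff)
    with h(2) show "AE x in lborel. u x = g x" by eventually_elim (auto simp: g_def)
  qed
qed

theorem (in symmetric_levy) liouville_iff:
  "liouville_property \<nu> \<longleftrightarrow> \<not> in_lattice charged"
proof
  assume not: "\<not> in_lattice charged"
  show "liouville_property \<nu>"
    unfolding liouville_property_def
  proof (intro allI impI, elim conjE)
    fix u assume "L_infinity u" and sol: "distributional_solution \<nu> u"
    from \<open>L_infinity u\<close> obtain g C where g [measurable]: "g \<in> borel_measurable borel"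
      and gC: "\<And>x. \<bar>g x\<bar> \<le> C" and ug: "AE x in lborel. u x = g x"
      by (rule L_infinity_borel_representative) blast
    have ug': "AE x in lebesgue. u x = g x" using ug by (simp add: AE_completion_iff)
    have u [measurable]: "u \<in> borel_measurable lebesgue" using \<open>L_infinity u\<close> by (simp add: L_infinity_def)
    have "distributional_solution \<nu> g"
      unfolding distributional_solution_def
    proof (intro allI impI)
      fix \<psi> assume \<psi>: "test_function \<psi>"
      have g' [measurable]: "g \<in> borel_measurable lebesgue" "levy_op \<nu> \<psi> \<in> borel_measurable lebesgue"
        using levy_op_measurable[OF \<psi>] g by (auto intro!: measurable_completion)
      have "(LINT x|lebesgue. g x * levy_op \<nu> \<psi> x) = (LINT x|lebesgue. u x * levy_op \<nu> \<psi> x)"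
        using ug' by (intro integral_cong_AE) (measurable, auto elim!: eventually_mono)
      then show "(LINT x|lebesgue. g x * levy_op \<nu> \<psi> x) = 0"
        using sol \<psi> by (simp add: distributional_solution_def)
    qed
    then obtain c where "AE x in lborel. g x = c"
      using AE_constant_if_solution[OF g gC _ constant_or_in_lattice[OF not]] by blast
    with ug have "AE x in lborel. u x = c" by eventually_elim simp
    then show "\<exists>c. AE x in lebesgue. u x = c" by (auto simp: AE_completion_iff)
  qed
next
  assume liouville: "liouville_property \<nu>"
  show "\<not> in_lattice charged"
  proof
    assume "in_lattice charged"
    then obtain d where d: "d > 0" "charged \<subseteq> range (\<lambda>k::int. of_int k * d)"
      unfolding in_lattice_def by blast
    let ?u = "\<lambda>x. cos (2 * pi / d * x)"
    have cont: "continuous_on UNIV ?u" by (intro continuous_intros)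
    then have "?u \<in> borel_measurable lebesgue"
      by (intro measurable_completion) (simp add: borel_measurable_continuous_onI)
    then have "L_infinity ?u"
      unfolding L_infinity_def by (auto intro!: exI[of _ 1])
    then obtain c where "AE x in lebesgue. ?u x = c"
      using liouville distributional_solution_cos[OF d] unfolding liouville_property_def by blast
    then obtain N where N: "{x. ?u x \<noteq> c} \<subseteq> N" "N \<in> null_sets lebesgue"
      by (auto elim!: AE_E intro: that simp: null_sets_def)
    \<comment> \<open>A null open set is empty, so the cosine would equal \<open>c\<close>
      everywhere, although it is 1 at 0 and -1 at \<open>d / 2\<close>.\<close>
    have "open {x. ?u x \<noteq> c}" by (intro open_Collect_neq continuous_intros)
    moreover have "negligible {x. ?u x \<noteq> c}"
      using N negligible_iff_null_sets negligible_subset by blast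
    ultimately have "{x. ?u x \<noteq> c} = {}" using open_not_negligible by blast
    then have "?u 0 = c" "?u (d / 2) = c" by blast+
    then show False using d(1) by simp
  qed
qed

section \<open>Transfer to measures on the punctured line\<close>

lemma uminus_image_eq: "uminus ` A = {x. - x \<in> A}" for A :: "'a::group_add set"
  by force

text \<open>The image of \<open>\<mu>\<close> under the inclusion into the line gives the origin
  mass 0 and changes neither \<open>levy_op\<close> on test functions nor the support away from the
  origin.\<close>

lemma liouville_property_iff:
  fixes \<mu> :: "real measure"
  assumes "punctured_radon \<mu>" and "symmetric_measure \<mu>"
    and "(\<integral>\<^sup>+ z. ennreal (min (\<bar>z\<bar>\<^sup>2) 1) \<partial>\<mu>) < \<infinity>"
  shows "liouville_property \<mu> \<longleftrightarrow> \<not> in_lattice (supp \<mu>)"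
proof -
  have sets: "sets \<mu> = sets (restrict_space borel (- {0}))"
    using assms(1) by (simp add: punctured_radon_def)
  have space: "space \<mu> = - {0}" using sets_eq_imp_space_eq[OF sets] by (simp add: space_restrict_space)
  have id: "(\<lambda>z. z) \<in> measurable \<mu> borel"
    unfolding measurable_cong_sets[OF sets refl] by (rule measurable_restrict_space1) simp
  have in_sets: "A \<inter> - {0} \<in> sets \<mu>" if "A \<in> sets borel" for A
    using that unfolding sets sets_restrict_space by auto
  define \<nu> where "\<nu> = distr \<mu> borel (\<lambda>z. z)"
  have em: "emeasure \<nu> A = emeasure \<mu> (A \<inter> - {0})" if "A \<in> sets borel" for A
    unfolding \<nu>_def using that by (subst emeasure_distr[OF id]) (auto simp: space)
  interpret symmetric_levy \<nu>
  proof
    show s: "sets \<nu> = sets borel" by (simp add: \<nu>_def)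
    show "emeasure \<nu> {0} = 0" by (simp add: em)
    show "distr \<nu> borel uminus = \<nu>"
    proof (rule measure_eqI)
      fix A assume "A \<in> sets (distr \<nu> borel uminus)"
      then have A: "A \<in> sets borel" by simp
      have uminus: "uminus \<in> measurable \<nu> borel"
        unfolding measurable_cong_sets[OF s refl] by simp
      have A': "uminus -` A \<in> sets borel" using measurable_sets[of uminus borel borel A] A by simp
      have "emeasure (distr \<nu> borel uminus) A = emeasure \<nu> (uminus -` A)"
        using A by (subst emeasure_distr[OF uminus]) (auto simp: sets_eq_imp_space_eq[OF s])
      also have "\<dots> = emeasure \<mu> (uminus -` A \<inter> - {0})" by (rule em[OF A'])
      also have "\<dots> = emeasure \<mu> (uminus ` (uminus -` A \<inter> - {0}))"
        using assms(2) in_sets[OF A'] by (simp add: symmetric_measure_def)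
      also have "uminus ` (uminus -` A \<inter> - {0}) = A \<inter> - {0::real}"
        by (auto simp: uminus_image_eq)
      finally show "emeasure (distr \<nu> borel uminus) A = emeasure \<nu> A" by (simp add: em[OF A])
    qed (simp add: s)
    show "(\<integral>\<^sup>+ z. ennreal (min (z\<^sup>2) 1) \<partial>\<nu>) < \<infinity>"
      unfolding \<nu>_def using assms(3) by (subst nn_integral_distr[OF id]) simp_all
  qed
  have supp: "supp \<mu> = charged"
    unfolding supp_def charged_def by (auto simp: em)
  have levy: "levy_op \<nu> \<psi> x = levy_op \<mu> \<psi> x" if "test_function \<psi>" for \<psi> x
  proof -
    have [measurable]: "\<psi> \<in> borel_measurable borel" by (rule test_function_measurable[OF that])
    have "set_lebesgue_integral \<nu> {z. \<bar>z\<bar> > r} (\<lambda>z. \<psi> (x + z) - \<psi> x) =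
        set_lebesgue_integral \<mu> {z. \<bar>z\<bar> > r} (\<lambda>z. \<psi> (x + z) - \<psi> x)" for r
      unfolding set_lebesgue_integral_def \<nu>_def by (rule integral_distr[OF id]) measurable
    then show ?thesis by (simp add: levy_op_def)
  qed
  have "liouville_property \<mu> \<longleftrightarrow> liouville_property \<nu>"
    unfolding liouville_property_def distributional_solution_def by (simp add: levy)
  then show ?thesis using liouville_iff supp by simp
qed

lemma symmetric_supp:
  assumes "punctured_radon \<mu>" "symmetric_measure \<mu>" "z \<in> supp \<mu>"
  shows "- z \<in> supp \<mu>"
proof -
  have sets: "sets \<mu> = sets (restrict_space borel (- {0}))"
    using assms(1) by (simp add: punctured_radon_def)
  have "emeasure \<mu> (ball (- z) r \<inter> - {0}) > 0" if "r > 0" for r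
  proof -
    have "ball z r \<inter> - {0} \<in> sets \<mu>" unfolding sets sets_restrict_space by auto
    then have "emeasure \<mu> (ball z r \<inter> - {0}) = emeasure \<mu> (uminus ` (ball z r \<inter> - {0}))"
      using assms(2) by (simp add: symmetric_measure_def)
    also have "uminus ` (ball z r \<inter> - {0}) = ball (- z) r \<inter> - {0}"
      by (auto simp: uminus_image_eq dist_real_def)
    finally show ?thesis using assms(3) that by (auto simp: supp_def)
  qed
  then show ?thesis using assms(3) by (auto simp: supp_def)
qed

text \<open>A limit point \<open>x\<close> need not lie in the lattice, so two points of
  \<open>S\<close> near \<open>x\<close> are compared with each other. Different distances to
  \<open>x\<close> make them distinct, yet they are closer than the spacing.\<close>

lemma in_lattice_no_limit_point:
  assumes "in_lattice S"
  shows "\<not> x islimpt S"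
proof
  assume x: "x islimpt S"
  obtain d where d: "d > 0" "S \<subseteq> range (\<lambda>k::int. of_int k * d)"
    using assms unfolding in_lattice_def by blast
  obtain y where y: "y \<in> S" "y \<noteq> x" "dist y x < d / 2"
    using x d(1) unfolding islimpt_approachable by (meson half_gt_zero)
  obtain z where z: "z \<in> S" "z \<noteq> x" "dist z x < dist y x"
    using x y(2) unfolding islimpt_approachable by (meson zero_less_dist_iff)
  obtain k l :: int where kl: "y = of_int k * d" "z = of_int l * d" using y(1) z(1) d(2) by blast
  have "dist y z < d" using y(3) z(3) dist_triangle2[of y z x] by linarith
  then have "\<bar>of_int (k - l)\<bar> * d < 1 * d"
    using d(1) by (simp add: kl dist_real_def left_diff_distrib[symmetric] abs_mult)
  then have "\<bar>of_int (k - l) :: real\<bar> < 1" using d(1) by (simp only: mult_less_cancel_right_pos)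
  then have "k = l" by linarith
  then show False using z(3) kl by simp
qed

text \<open>A nondegenerate interval has limit points, and a set and its closure have the same
  ones.\<close>

lemma interval_or_accumulation_iff:
  "interval_or_accumulation (closure S) \<longleftrightarrow> (\<exists>x. x islimpt S)"
proof
  assume "interval_or_accumulation (closure S)"
  then consider c d where "c < d" "{c..d} \<subseteq> closure S" | x where "x islimpt closure S"
    unfolding interval_or_accumulation_def by blast
  then show "\<exists>x. x islimpt S"
  proof cases
    case 1
    then have "c islimpt {c..d}" by simp
    then have "c islimpt closure S" using 1(2) by (rule islimpt_subset)
    then show ?thesis by (auto simp: limpt_of_closure)
  qed (auto simp: limpt_of_closure)
qed (auto simp: interval_or_accumulation_def limpt_of_closure)

section \<open>Denominators of ratios and lattices\<close>

lemma denominator_eq: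
  assumes "coprime p (int q)" "q > 0" "x = of_int p / of_nat q"
  shows "denominator x = enat q"
proof -
  have "(THE q. 0 < q \<and> (\<exists>p::int. coprime p (int q) \<and> x = of_int p / of_nat q)) = q"
  proof (rule the_equality)
    fix q' assume "0 < q' \<and> (\<exists>p::int. coprime p (int q') \<and> x = of_int p / of_nat q')"
    then obtain p' where p': "q' > 0" "coprime p' (int q')" "x = of_int p' / of_nat q'" by blast
    have "(of_int (p * int q') :: real) = of_int (p' * int q)"
      using assms p' by (simp add: field_simps)
    then have eq: "p * int q' = p' * int q" by (simp only: of_int_eq_iff)
    \<comment> \<open>By coprimality each denominator divides the other, so the definite description
      has a unique candidate.\<close>
    have "int q dvd p * int q'" "int q' dvd p' * int q" by (simp add: eq, simp add: eq[symmetric])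
    then have "int q dvd int q'" "int q' dvd int q"
      using assms(1) p'(2) by (simp_all add: coprime_dvd_mult_right_iff coprime_commute)
    then show "q' = q" by (simp add: dvd_antisym)
  qed (use assms in auto)
  moreover have "x \<in> \<rat>" using assms(3) by simp
  ultimately show ?thesis by (simp add: denominator_def)
qed

lemma denominator_rational:
  assumes "x \<in> \<rat>"
  obtains p q where "q > 0" "x = of_int p / of_nat q" "denominator x = enat q"
proof -
  obtain a b where ab: "b > 0" "coprime a b" "x = of_int a / of_int b"
    using Rats_cases'[OF assms] by blast
  have "denominator x = enat (nat b)" using ab by (intro denominator_eq[of a]) auto
  with ab show thesis by (intro that[of "nat b" a]) auto
qed

lemma Rats_if_denominator_le:
  assumes "denominator x \<le> enat Q"
  shows "x \<in> \<rat>"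
  using assms by (cases "x \<in> \<rat>") (simp_all add: denominator_def)

lemma denominator_fraction_le:
  assumes "m > 0" "x = of_int k / of_nat m"
  shows "denominator x \<le> enat m"
proof -
  define g where "g = gcd k (int m)"
  have g: "g > 0" using assms(1) by (simp add: g_def gcd_pos_int)
  have k: "k = (k div g) * g" and m: "int m = (int m div g) * g" by (simp_all add: g_def)
  have q: "int m div g > 0" using g assms(1) m by (metis of_nat_0_less_iff zero_less_mult_pos2)
  have "denominator x = enat (nat (int m div g))"
  proof (rule denominator_eq)
    show "coprime (k div g) (int (nat (int m div g)))"
      using q assms(1) div_gcd_coprime[of k "int m"] by (simp add: g_def)
    have "real m = of_int (int m div g) * of_int g" using m by (metis of_int_mult of_int_of_nat_eq)
    moreover have "real_of_int k = of_int (k div g) * of_int g" using k by (metis of_int_mult)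
    ultimately have "x = of_int (k div g) / of_int (int m div g)"
      using g by (simp add: assms(2))
    then show "x = of_int (k div g) / of_nat (nat (int m div g))" using q by simp
  qed (use q in simp)
  moreover have "int m div g \<le> int m"
    using assms(1) by (intro zdvd_imp_le dvdI[OF m]) simp
  ultimately show ?thesis by simp
qed

text \<open>If \<open>a 1\<close> is the m-th multiple of the spacing, all ratios are fractions over
  m; conversely, bounded denominators have a common multiple. An irrational ratio has denominator
  \<open>\<infinity>\<close> and violates every bound. A general \<open>I\<close> lets finite and
  infinite supports share the proof.\<close>

lemma in_lattice_listing_iff:
  assumes S: "symmetric_listing I a S" and "1 \<in> I"
  shows "in_lattice S \<longleftrightarrow> (\<exists>Q. \<forall>n\<in>I. denominator (a n / a 1) \<le> enat Q)"
proof
  have a1: "a 1 > 0" using assms by (auto simp: symmetric_listing_def)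
  have aS: "a n \<in> S" if "n \<in> I" for n using S that by (auto simp: symmetric_listing_def)
  {
    assume "in_lattice S"
    then obtain d where d: "d > 0" "S \<subseteq> range (\<lambda>k::int. of_int k * d)"
      unfolding in_lattice_def by blast
    obtain m :: int where m: "a 1 = of_int m * d" using d(2) aS[OF \<open>1 \<in> I\<close>] by blast
    then have "m > 0" using a1 d(1) by (simp add: zero_less_mult_iff)
    have "denominator (a n / a 1) \<le> enat (nat m)" if n: "n \<in> I" for n
    proof -
      obtain k :: int where k: "a n = of_int k * d" using d(2) aS[OF n] by blast
      have "a n / a 1 = of_int k / of_nat (nat m)" using d(1) \<open>m > 0\<close> by (simp add: m k del: One_nat_def)
      then show ?thesis using \<open>m > 0\<close> by (intro denominator_fraction_le) auto
    qed
    then show "\<exists>Q. \<forall>n\<in>I. denominator (a n / a 1) \<le> enat Q" by blast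
  next
    assume "\<exists>Q. \<forall>n\<in>I. denominator (a n / a 1) \<le> enat Q"
    then obtain Q where Q: "\<And>n. n \<in> I \<Longrightarrow> denominator (a n / a 1) \<le> enat Q" by blast
    \<comment> \<open>Every positive q up to \<open>Q\<close> divides the factorial of
      \<open>Q\<close>, so (p/q) \<open>a 1\<close> is an integer multiple of
      \<open>d\<close>.\<close>
    define d where "d = a 1 / fact Q"
    have d: "d > 0" using a1 by (simp add: d_def)
    have "\<exists>k::int. a n = of_int k * d" if n: "n \<in> I" for n
    proof -
      have "a n / a 1 \<in> \<rat>" using Q[OF n] by (rule Rats_if_denominator_le)
      then obtain p q where pq: "q > 0" "a n / a 1 = of_int p / of_nat q"
          "denominator (a n / a 1) = enat q"
        by (rule denominator_rational)
      then have "q dvd fact Q" using Q[OF n] by (simp add: dvd_fact)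
      then obtain t where t: "fact Q = q * t" by blast
      have "(fact Q :: real) = of_nat (fact Q)" by simp
      also have "\<dots> = real q * real t" by (simp only: t of_nat_mult)
      finally have f: "(fact Q :: real) = real q * real t" .
      have "t > 0" using t by (cases t) auto
      have "a n = (of_int p / of_nat q) * a 1" using pq(2) a1 by (simp add: field_simps)
      also have "a 1 = real q * real t * d" unfolding f[symmetric] d_def by simp
      also have "of_int p / of_nat q * (real q * real t * d) = of_int (p * int t) * d"
        using pq(1) by simp
      finally show ?thesis by blast
    qed
    then have *: "a n \<in> range (\<lambda>k::int. of_int k * d)" if "n \<in> I" for n using that by blast
    have "- x \<in> range (\<lambda>k::int. of_int k * d)" if "x \<in> range (\<lambda>k::int. of_int k * d)" for x
      using that by (auto intro: range_eqI[of _ _ "- k" for k])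
    then have "S \<subseteq> range (\<lambda>k::int. of_int k * d)"
      using S * unfolding symmetric_listing_def by blast
    with d show "in_lattice S" unfolding in_lattice_def by blast
  }
qed

lemma SUP_enat_eq_infinity_iff:
  fixes f :: "'a \<Rightarrow> enat"
  shows "(SUP x\<in>A. f x) = \<infinity> \<longleftrightarrow> \<not> (\<exists>Q. \<forall>x\<in>A. f x \<le> enat Q)"
proof -
  have "(SUP x\<in>A. f x) \<noteq> \<infinity> \<longleftrightarrow> (\<exists>Q. (SUP x\<in>A. f x) \<le> enat Q)"
    by (cases "SUP x\<in>A. f x") auto
  then show ?thesis unfolding SUP_le_iff by blast
qed

section \<open>Existence of increasing listings\<close>

lemma symmetric_listing_by_rank:
  fixes r :: "real \<Rightarrow> nat"
  assumes T: "\<And>t. t \<in> T \<Longrightarrow> t > 0" and r: "strict_mono_on T r"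
    and e: "bij_betw e J (r ` T)" "strict_mono_on J e"
  shows "symmetric_listing (Suc ` J) (\<lambda>n. inv_into T r (e (n - 1))) (\<Union>t\<in>T. {- t, t})"
proof -
  \<comment> \<open>\<open>b m\<close> is the point of \<open>T\<close> with rank
    \<open>e m\<close>. In both uses \<open>J\<close> starts at 0 while listings start at 1, hence
    \<open>Suc\<close> and \<open>n - 1\<close>.\<close>
  define b where "b m = inv_into T r (e m)" for m
  have eJ: "e m \<in> r ` T" if "m \<in> J" for m using e(1) that by (auto simp: bij_betw_def)
  have b: "b m \<in> T" "r (b m) = e m" if "m \<in> J" for m
    using eJ[OF that] by (auto simp: b_def inv_into_into f_inv_into_f)
  have inj: "inj_on r T" using r by (rule strict_mono_on_imp_inj_on)
  have img: "b ` J = T"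
  proof safe
    fix t assume "t \<in> T"
    then have "r t \<in> e ` J" using e(1) by (auto simp: bij_betw_def)
    then obtain m where m: "m \<in> J" "r t = e m" by blast
    then have "b m = t" using inv_into_f_f[OF inj \<open>t \<in> T\<close>] by (simp add: b_def)
    then show "t \<in> b ` J" using m(1) by blast
  qed (use b in auto)
  have mono: "b m < b n" if "m \<in> J" "n \<in> J" "m < n" for m n
  proof (rule ccontr)
    assume "\<not> b m < b n"
    then consider "b m = b n" | "b n < b m" by linarith
    then have "r (b n) \<le> r (b m)"
      using r b(1)[OF that(1)] b(1)[OF that(2)] by cases (auto dest: strict_mono_onD)
    then show False using b(2)[OF that(1)] b(2)[OF that(2)] strict_mono_onD[OF e(2) that] by simp
  qed
  have "(\<Union>n\<in>Suc ` J. {- b (n - 1), b (n - 1)}) = (\<Union>t\<in>b ` J. {- t, t})" by auto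
  then show ?thesis
    unfolding symmetric_listing_def b_def[symmetric] img
    using b(1) T mono by (auto simp: strict_mono_on_def)
qed

text \<open>By Bolzano-Weierstrass only finitely many positive points lie below any bound, even near
  0. Counting them ranks the points by natural numbers, and sets of naturals can be enumerated
  increasingly.\<close>

lemma symmetric_listing_exists:
  fixes S :: "real set"
  assumes sym: "\<And>z. z \<in> S \<Longrightarrow> - z \<in> S" and "0 \<notin> S" and no_limit: "\<And>x. \<not> x islimpt S"
  shows "finite S \<Longrightarrow> \<exists>N a. symmetric_listing {1..N} a S"
    and "infinite S \<Longrightarrow> \<exists>a. symmetric_listing {1..} a S"
proof -
  define T where "T = S \<inter> {0<..}"
  have S: "S = (\<Union>t\<in>T. {- t, t})"
  proof safe
    fix x assume "x \<in> S"
    show "x \<in> (\<Union>t\<in>T. {- t, t})"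
    proof (cases "x > 0")
      case True
      then show ?thesis using \<open>x \<in> S\<close> by (auto simp: T_def)
    next
      case False
      then have "- x \<in> T" using \<open>x \<in> S\<close> \<open>0 \<notin> S\<close> sym[of x] by (cases "x = 0") (auto simp: T_def)
      then show ?thesis by (intro UN_I[of "- x"]) auto
    qed
  qed (use sym in \<open>auto simp: T_def\<close>)
  have fin: "finite (T \<inter> {..x})" for x
  proof (rule ccontr)
    assume inf: "infinite (T \<inter> {..x})"
    have "bounded (T \<inter> {..x})"
      by (rule bounded_subset[OF bounded_closed_interval[of 0 x]]) (auto simp: T_def)
    then obtain y where "y islimpt T \<inter> {..x}"
      using bounded_infinite_imp_islimpt[OF order_refl _ inf] by blast
    then have "y islimpt S" by (rule islimpt_subset) (auto simp: T_def)
    then show False using no_limit by blast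
  qed
  \<comment> \<open>\<open>fin\<close> matters here, since \<open>card\<close> of an infinite set is
    0. Enumerating the set of ranks avoids proving that they are consecutive.\<close>
  define r where "r t = card (T \<inter> {..t})" for t
  have r: "strict_mono_on T r"
  proof (rule strict_mono_onI)
    fix s t assume "s \<in> T" "t \<in> T" "s < t"
    then have "T \<inter> {..s} \<subseteq> T \<inter> {..t}" "t \<in> T \<inter> {..t}" "t \<notin> T \<inter> {..s}" by auto
    then have "T \<inter> {..s} \<subset> T \<inter> {..t}" by blast
    then show "r s < r t" unfolding r_def by (rule psubset_card_mono[OF fin])
  qed
  have T: "t > 0" if "t \<in> T" for t using that by (simp add: T_def)
  show "\<exists>N a. symmetric_listing {1..N} a S" if "finite S"
  proof -
    have "finite (r ` T)" using that by (simp add: T_def)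
    then obtain e where "bij_betw e {..<card (r ` T)} (r ` T)" "strict_mono_on {..<card (r ` T)} e"
      by (rule ex_bij_betw_strict_mono_card)
    from symmetric_listing_by_rank[OF T r this]
    show ?thesis unfolding S[symmetric] image_Suc_lessThan by blast
  qed
  show "\<exists>a. symmetric_listing {1..} a S" if "infinite S"
  proof -
    have "infinite T" using that S by auto
    then have inf: "infinite (r ` T)"
      using finite_imageD[OF _ strict_mono_on_imp_inj_on[OF r]] by blast
    have "strict_mono_on UNIV (enumerate (r ` T))"
      using enumerate_mono[OF _ inf] by (intro strict_mono_onI) auto
    from symmetric_listing_by_rank[OF T r bij_enumerate[OF inf] this]
    moreover have "range Suc = {1..}"
      by (simp add: greaterThan_0[symmetric] atLeast_Suc_greaterThan)
    ultimately show ?thesis unfolding S[symmetric] by auto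
  qed
qed

text \<open>The existence clauses show that the listings quantified over do exist; the equivalences
  then hold for each of them.\<close>

theorem corollary3p8:
  fixes \<mu> :: "real measure"
  assumes "punctured_radon \<mu>"
    and "symmetric_measure \<mu>"
    and "(\<integral>\<^sup>+ z. ennreal (min (\<bar>z\<bar>\<^sup>2) 1) \<partial>\<mu>) < \<infinity>"
  shows "(interval_or_accumulation (closure (supp \<mu>)) \<longrightarrow> liouville_property \<mu>) \<and>
    (\<not> interval_or_accumulation (closure (supp \<mu>)) \<longrightarrow>
      (finite (supp \<mu>) \<longrightarrow>
        (\<exists>N a. symmetric_listing {1..N} a (supp \<mu>)) \<and>
        (\<forall>N a. symmetric_listing {1..N} a (supp \<mu>) \<longrightarrow>
          (liouville_property \<mu> \<longleftrightarrow> (\<exists>n\<in>{1..N}. a n / a 1 \<notin> \<rat>)))) \<and>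
      (infinite (supp \<mu>) \<longrightarrow>
        (\<exists>a. symmetric_listing {1..} a (supp \<mu>)) \<and>
        (\<forall>a. symmetric_listing {1..} a (supp \<mu>) \<longrightarrow>
          (liouville_property \<mu> \<longleftrightarrow> (SUP n\<in>{1..}. denominator (a n / a 1)) = \<infinity>))))"
proof -
  note liouville = liouville_property_iff[OF assms]
  have sym: "- z \<in> supp \<mu>" if "z \<in> supp \<mu>" for z by (rule symmetric_supp[OF assms(1,2) that])
  have nz: "0 \<notin> supp \<mu>" by (simp add: supp_def)
  have finite_case: "liouville_property \<mu> \<longleftrightarrow> (\<exists>n\<in>{1..N}. a n / a 1 \<notin> \<rat>)"
    if S: "symmetric_listing {1..N} a (supp \<mu>)" for N a
  proof (cases "N = 0")
    case True
    \<comment> \<open>For \<open>N = 0\<close> the value \<open>a 1\<close> is unconstrained, so the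
      ratios mean nothing. The empty support lies in a lattice, and both sides are false.\<close>
    then have "supp \<mu> = {}" using S by (simp add: symmetric_listing_def)
    then have "in_lattice (supp \<mu>)" unfolding in_lattice_def by (auto intro: exI[of _ 1])
    with True show ?thesis by (simp add: liouville)
  next
    case False
    then have "1 \<in> {1..N}" by simp
    have "(\<exists>Q. \<forall>n\<in>{1..N}. denominator (a n / a 1) \<le> enat Q) \<longleftrightarrow> (\<forall>n\<in>{1..N}. a n / a 1 \<in> \<rat>)"
    proof
      assume "\<exists>Q. \<forall>n\<in>{1..N}. denominator (a n / a 1) \<le> enat Q"
      then show "\<forall>n\<in>{1..N}. a n / a 1 \<in> \<rat>" using Rats_if_denominator_le by blast
    next
      assume "\<forall>n\<in>{1..N}. a n / a 1 \<in> \<rat>"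
      then have "\<forall>n\<in>{1..N}. \<exists>q. denominator (a n / a 1) = enat q"
        by (auto simp: denominator_def simp del: One_nat_def)
      then obtain q where q: "\<And>n. n \<in> {1..N} \<Longrightarrow> denominator (a n / a 1) = enat (q n)" by metis
      \<comment> \<open>Finitely many finite denominators have a maximum, so here boundedness is
        rationality of all ratios.\<close>
      have "denominator (a n / a 1) \<le> enat (Max (q ` {1..N}))" if "n \<in> {1..N}" for n
        unfolding q[OF that] enat_ord_simps using that by (intro Max_ge) auto
      then show "\<exists>Q. \<forall>n\<in>{1..N}. denominator (a n / a 1) \<le> enat Q" by blast
    qed
    then show ?thesis unfolding liouville in_lattice_listing_iff[OF S \<open>1 \<in> {1..N}\<close>] by blast
  qed
  have infinite_case: "liouville_property \<mu> \<longleftrightarrow> (SUP n\<in>{1..}. denominator (a n / a 1)) = \<infinity>"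
    if "symmetric_listing {1..} a (supp \<mu>)" for a
    unfolding liouville SUP_enat_eq_infinity_iff using in_lattice_listing_iff[OF that] by simp
  have accumulation: "liouville_property \<mu>" if "interval_or_accumulation (closure (supp \<mu>))"
    using that in_lattice_no_limit_point unfolding liouville interval_or_accumulation_iff by blast
  have listing: "finite (supp \<mu>) \<Longrightarrow> \<exists>N a. symmetric_listing {1..N} a (supp \<mu>)"
      "infinite (supp \<mu>) \<Longrightarrow> \<exists>a. symmetric_listing {1..} a (supp \<mu>)"
    if "\<not> interval_or_accumulation (closure (supp \<mu>))"
    using symmetric_listing_exists[of "supp \<mu>"] sym nz that
    unfolding interval_or_accumulation_iff by blast+
  show ?thesis
    by (intro conjI impI allI) (rule accumulation listing finite_case infinite_case; assumption)+
qed

end
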